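(* Let $(r_1,r_2,\dots)$ be nonnegative reals with $\sum_ir_i=1$, and let $\Phi$ be the unique element of $\mathrm{End}(\mathcal{Q})$ satisfying $\Phi(G)(1,0,0,\dots)=G(r_1,r_2,\dots)$ for all $G\in\mathcal{Q}$. Let $\delta_1,\delta_2,\dots$ be i.i.d.\ random variables with $\mathrm{Prob}(\delta_i=j-1)=r_j$ for every positive integer $j$. Then for all $n$, all $\sigma,\tau\in\mathfrak{S}_n$ and $\beta\in\operatorname{Comp}(n)$, $$K^\Phi_n(\sigma,\tau)=\mathrm{Prob}\big(\operatorname{st}((\sigma_1+\delta_1n,\dots,\sigma_n+\delta_nn))=\tau\big),$$ $$\overline{K}^\Phi_n(D(\sigma),\beta)=\mathrm{Prob}\big(D((\sigma_1+\delta_1n,\dots,\sigma_n+\delta_nn))=\beta\big).$$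
   Context: Work over $\mathbb{R}$. Compositions $\alpha=(a_1,\dots,a_k)$ of $n$, $\operatorname{Comp}(n)$, $(n)$, $S_\alpha=\{a_1,\dots,a_1+\dots+a_{k-1}\}$, $\operatorname{co}$ its inverse, $\alpha\le\beta$ iff $S_\alpha\subseteq S_\beta$. $M_\alpha=\sum_{i_1<\dots<i_k}x_{i_1}^{a_1}\cdots x_{i_k}^{a_k}$; $\mathcal{Q}$ the graded Hopf algebra of quasisymmetric functions (deconcatenation coproduct on $M_\alpha$); $F_\alpha=\sum_{\beta\ge\alpha}M_\beta$; $\mathrm{End}(\mathcal{Q})$ = graded Hopf algebra endomorphisms. For a sequence $w$ of $n$ distinct reals, $D(w)=\operatorname{co}(\{i:w_i>w_{i+1}\})$ and $\operatorname{st}(w)$ is the permutation $\tau\in\mathfrak{S}_n$ with $w_i<w_j\iff\tau_i<\tau_j$; permutations are in one-line notation with product = composition. For $\Phi\in\mathrm{End}(\mathcal{Q})$: $c_{\alpha,\beta}$ by $\Phi(F_\alpha)=\sum_\beta c_{\alpha,\beta}F_\beta$, $\lambda$ by $\Phi(M_{(1)})=\lambda M_{(1)}$, $\mathrm{Prob}_\Phi(\pi)=c_{D(\pi),(n)}/\sum_\sigma c_{D(\sigma),(n)}$, $K^\Phi_n(\pi,\sigma\pi)=\mathrm{Prob}_\Phi(\sigma^{-1})$, $\overline{K}^\Phi_n(\alpha,\beta)=c_{\alpha,\beta}/\lambda^n$. *)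

theory Defs
  imports "HOL-Probability.Probability" "HOL-Library.Poly_Mapping"
    "HOL-Combinatorics.Permutations"
begin

section \<open>Compositions, descents and standardisation\<close>

definition is_comp :: "nat list \<Rightarrow> bool" where
  "is_comp \<alpha> \<longleftrightarrow> (\<forall>a\<in>set \<alpha>. 0 < a)"

definition Comp :: "nat \<Rightarrow> nat list set" where
  "Comp n = {\<alpha>. is_comp \<alpha> \<and> sum_list \<alpha> = n}"

text \<open>The composition \<open>(n)\<close>; for \<open>n = 0\<close> this is read as the empty composition,
  the only element of \<open>Comp 0\<close>.\<close>

definition single_comp :: "nat \<Rightarrow> nat list" where
  "single_comp n = (if n = 0 then [] else [n])"

definition partial_sums :: "nat list \<Rightarrow> nat set" where
  "partial_sums \<alpha> = {sum_list (take j \<alpha>) | j. 1 \<le> j \<and> j < length \<alpha>}"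

definition co :: "nat \<Rightarrow> nat set \<Rightarrow> nat list" where
  "co n = the_inv_into (Comp n) partial_sums"

definition refines :: "nat list \<Rightarrow> nat list \<Rightarrow> bool" where
  "refines \<beta> \<alpha> \<longleftrightarrow> sum_list \<alpha> = sum_list \<beta> \<and> partial_sums \<alpha> \<subseteq> partial_sums \<beta>"

text \<open>Positions in words are counted from 1, so \<open>w\<^sub>i\<close> is \<open>w ! (i - 1)\<close>. A permutation
  \<open>\<pi>\<close> of \<open>{1..n}\<close> has the one-line word \<open>word n \<pi>\<close>.\<close>

definition desc_comp :: "real list \<Rightarrow> nat list" where
  "desc_comp w = co (length w) {i. 1 \<le> i \<and> i < length w \<and> w ! (i - 1) > w ! i}"

definition st :: "real list \<Rightarrow> nat \<Rightarrow> nat" where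
  "st w = (THE \<tau>. \<tau> permutes {1..length w} \<and>
     (\<forall>i\<in>{1..length w}. \<forall>j\<in>{1..length w}. w ! (i - 1) < w ! (j - 1) \<longleftrightarrow> \<tau> i < \<tau> j))"

definition word :: "nat \<Rightarrow> (nat \<Rightarrow> nat) \<Rightarrow> real list" where
  "word n v = map (\<lambda>i. real (v i)) [1..<n + 1]"

section \<open>Power series in countably many variables\<close>

text \<open>A formal power series is its coefficient function on monomials. The index \<open>i\<close> stands
  for the variable \<open>x\<^sub>i\<^sub>+\<^sub>1\<close>.\<close>

type_synonym monomial = "nat \<Rightarrow>\<^sub>0 nat"
type_synonym pseries = "monomial \<Rightarrow> real"

definition deg :: "monomial \<Rightarrow> nat" where
  "deg m = (\<Sum>i\<in>Poly_Mapping.keys m. Poly_Mapping.lookup m i)"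

definition mon :: "nat list \<Rightarrow> nat list \<Rightarrow> monomial" where
  "mon is \<alpha> = (\<Sum>j<length \<alpha>. Poly_Mapping.single (is ! j) (\<alpha> ! j))"

definition ps_one :: pseries where
  "ps_one m = of_bool (m = 0)"

definition ps_mult :: "pseries \<Rightarrow> pseries \<Rightarrow> pseries" where
  "ps_mult f g m = (\<Sum>(a, b)\<in>{(a, b). a + b = m}. f a * g b)"

definition homogeneous :: "nat \<Rightarrow> pseries \<Rightarrow> bool" where
  "homogeneous d f \<longleftrightarrow> (\<forall>m. f m \<noteq> 0 \<longrightarrow> deg m = d)"

definition ps_eval :: "pseries \<Rightarrow> (nat \<Rightarrow> real) \<Rightarrow> real" where
  "ps_eval f p = (\<Sum>\<^sub>\<infinity>m. f m * (\<Prod>i\<in>Poly_Mapping.keys m. p i ^ Poly_Mapping.lookup m i))"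

section \<open>Quasisymmetric functions\<close>

definition QSym :: "pseries set" where
  "QSym = {f. (\<exists>d. \<forall>m. f m \<noteq> 0 \<longrightarrow> deg m \<le> d) \<and>
     (\<forall>\<alpha> is js. is_comp \<alpha> \<longrightarrow> length is = length \<alpha> \<longrightarrow> length js = length \<alpha> \<longrightarrow>
        sorted_wrt (<) is \<longrightarrow> sorted_wrt (<) js \<longrightarrow> f (mon is \<alpha>) = f (mon js \<alpha>))}"

definition QM :: "nat list \<Rightarrow> pseries" where
  "QM \<alpha> m = real (card {is. length is = length \<alpha> \<and> sorted_wrt (<) is \<and> mon is \<alpha> = m})"

definition QF :: "nat list \<Rightarrow> pseries" where
  "QF \<alpha> m = (\<Sum>\<beta>\<in>{\<beta>\<in>Comp (sum_list \<alpha>). refines \<beta> \<alpha>}. QM \<beta> m)"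

text \<open>The coefficient of \<open>QM \<alpha>\<close> in a quasisymmetric function is that of
  \<open>x\<^sub>1\<^bsup>a\<^sub>1\<^esup> \<dots> x\<^sub>k\<^bsup>a\<^sub>k\<^esup>\<close>.\<close>

definition first_mon :: "nat list \<Rightarrow> monomial" where
  "first_mon \<alpha> = mon [0..<length \<alpha>] \<alpha>"

text \<open>The tensor square of \<open>QSym\<close> is realised inside the power series in two sets of variables;
  the products \<open>tensor (QM \<alpha>) (QM \<beta>)\<close> form a basis of it, with coefficients read off
  at \<open>(first_mon \<alpha>, first_mon \<beta>)\<close>. Both maps below are the linear extensions of their
  values on these bases, the sums being finite by boundedness of the degree.\<close>

definition tensor :: "pseries \<Rightarrow> pseries \<Rightarrow> monomial \<times> monomial \<Rightarrow> real" where
  "tensor f g = (\<lambda>(a, b). f a * g b)"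

definition coprod :: "pseries \<Rightarrow> monomial \<times> monomial \<Rightarrow> real" where
  "coprod f p = (\<Sum>\<alpha>\<in>{\<alpha>. is_comp \<alpha> \<and> f (first_mon \<alpha>) \<noteq> 0}.
     f (first_mon \<alpha>) * (\<Sum>i\<le>length \<alpha>. tensor (QM (take i \<alpha>)) (QM (drop i \<alpha>)) p))"

definition tensor_map ::
    "(pseries \<Rightarrow> pseries) \<Rightarrow> (monomial \<times> monomial \<Rightarrow> real) \<Rightarrow> monomial \<times> monomial \<Rightarrow> real" where
  "tensor_map \<Phi> t p =
     (\<Sum>(\<alpha>, \<beta>)\<in>{(\<alpha>, \<beta>). is_comp \<alpha> \<and> is_comp \<beta> \<and> t (first_mon \<alpha>, first_mon \<beta>) \<noteq> 0}.
        t (first_mon \<alpha>, first_mon \<beta>) * tensor (\<Phi> (QM \<alpha>)) (\<Phi> (QM \<beta>)) p)"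

text \<open>The counit takes the constant term. Compatibility with the antipode is automatic for
  bialgebra morphisms between Hopf algebras. Only the values of \<open>\<Phi>\<close> on \<open>QSym\<close> matter.\<close>

definition End_QSym :: "(pseries \<Rightarrow> pseries) set" where
  "End_QSym = {\<Phi>.
     (\<forall>f\<in>QSym. \<Phi> f \<in> QSym) \<and>
     (\<forall>f\<in>QSym. \<forall>g\<in>QSym. \<Phi> (\<lambda>m. f m + g m) = (\<lambda>m. \<Phi> f m + \<Phi> g m)) \<and>
     (\<forall>f\<in>QSym. \<forall>s. \<Phi> (\<lambda>m. s * f m) = (\<lambda>m. s * \<Phi> f m)) \<and>
     \<Phi> ps_one = ps_one \<and>
     (\<forall>f\<in>QSym. \<forall>g\<in>QSym. \<Phi> (ps_mult f g) = ps_mult (\<Phi> f) (\<Phi> g)) \<and>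
     (\<forall>f\<in>QSym. \<forall>d. homogeneous d f \<longrightarrow> homogeneous d (\<Phi> f)) \<and>
     (\<forall>f\<in>QSym. coprod (\<Phi> f) = tensor_map \<Phi> (coprod f)) \<and>
     (\<forall>f\<in>QSym. \<Phi> f 0 = f 0)}"

section \<open>The chains attached to an endomorphism\<close>

text \<open>\<open>\<Phi> (QF \<alpha>)\<close> is homogeneous of degree \<open>sum_list \<alpha>\<close>, so the expansion in
  the basis of the \<open>QF \<beta>\<close> only involves \<open>\<beta>\<close> of the same size as \<open>\<alpha>\<close>.\<close>

definition F_coeff :: "(pseries \<Rightarrow> pseries) \<Rightarrow> nat list \<Rightarrow> nat list \<Rightarrow> real" where
  "F_coeff \<Phi> \<alpha> = (THE c. (\<forall>\<beta>. \<beta> \<notin> Comp (sum_list \<alpha>) \<longrightarrow> c \<beta> = 0) \<and>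
     \<Phi> (QF \<alpha>) = (\<lambda>m. \<Sum>\<beta>\<in>Comp (sum_list \<alpha>). c \<beta> * QF \<beta> m))"

definition eigval :: "(pseries \<Rightarrow> pseries) \<Rightarrow> real" where
  "eigval \<Phi> = (THE l. \<Phi> (QM [1]) = (\<lambda>m. l * QM [1] m))"

definition Prob_End :: "(pseries \<Rightarrow> pseries) \<Rightarrow> nat \<Rightarrow> (nat \<Rightarrow> nat) \<Rightarrow> real" where
  "Prob_End \<Phi> n \<pi> = F_coeff \<Phi> (desc_comp (word n \<pi>)) (single_comp n) /
     (\<Sum>\<sigma>\<in>{\<sigma>. \<sigma> permutes {1..n}}. F_coeff \<Phi> (desc_comp (word n \<sigma>)) (single_comp n))"

text \<open>A pair \<open>(\<pi>, \<rho>)\<close> is \<open>(\<pi>, \<sigma> \<circ> \<pi>)\<close> for \<open>\<sigma> = \<rho> \<circ> inv \<pi>\<close>.\<close>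

definition K_perm :: "(pseries \<Rightarrow> pseries) \<Rightarrow> nat \<Rightarrow> (nat \<Rightarrow> nat) \<Rightarrow> (nat \<Rightarrow> nat) \<Rightarrow> real" where
  "K_perm \<Phi> n \<pi> \<rho> = Prob_End \<Phi> n (inv (\<rho> \<circ> inv \<pi>))"

definition K_comp :: "(pseries \<Rightarrow> pseries) \<Rightarrow> nat \<Rightarrow> nat list \<Rightarrow> nat list \<Rightarrow> real" where
  "K_comp \<Phi> n \<alpha> \<beta> = F_coeff \<Phi> \<alpha> \<beta> / eigval \<Phi> ^ n"

end

theory Submission imports Defs begin

text \<open>Evaluating at \<open>(1, 0, 0, \<dots>)\<close> picks out the coefficient of \<open>M\<^bsub>(n)\<^esub>\<close>, so
  \<open>c\<^bsub>\<alpha>,(n)\<^esub> = F\<^sub>\<alpha>(r)\<close>. Expanding \<open>F\<^sub>\<alpha>(r)\<close> over the weakly increasing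
  index sequences that increase strictly at \<open>S\<^sub>\<alpha>\<close> shows that this is the probability that the
  word \<open>\<sigma>\<^sub>i + \<delta>\<^sub>i n\<close> has no descents, for any \<open>\<sigma>\<close> with
  \<open>D(\<sigma>) = \<alpha>\<close>. The coproduct extends this to all coefficients: the coefficient of
  \<open>M\<^sub>\<beta>\<close> in \<open>\<Phi>(F\<^sub>\<alpha>)\<close> is the product, over the blocks of \<open>\<beta>\<close>,
  of the no-descent probabilities of the subwords of \<open>\<sigma>\<close>, and by independence of the
  \<open>\<delta>\<^sub>i\<close> this is the probability that all descents of the shifted word lie in
  \<open>S\<^sub>\<beta>\<close>. Triangularity of the \<open>F\<close>-basis then gives the statement on
  compositions. The statement on permutations is the case \<open>\<beta> = (n)\<close>, because a word
  \<open>w\<close> has standardisation \<open>\<tau>\<close> iff \<open>w \<circ> \<tau>\<^sup>-\<^sup>1\<close> is increasing.\<close>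

section \<open>Compositions and descent sets\<close>

lemma is_comp_simps [simp]:
  "is_comp []" "is_comp (a # \<alpha>) \<longleftrightarrow> 0 < a \<and> is_comp \<alpha>"
  "is_comp (\<alpha> @ \<beta>) \<longleftrightarrow> is_comp \<alpha> \<and> is_comp \<beta>"
  by (auto simp: is_comp_def)

lemma partial_sums_Nil [simp]: "partial_sums [] = {}"
  by (simp add: partial_sums_def)

text \<open>The total is never a partial sum, so \<open>a\<close> itself counts only when some part
  follows it; hence the case distinction.\<close>

lemma partial_sums_Cons:
  "partial_sums (a # \<alpha>) = (if \<alpha> = [] then {} else insert a ((+) a ` partial_sums \<alpha>))"
proof (cases "\<alpha> = []")
  case True
  then show ?thesis by (auto simp: partial_sums_def)
next
  case False
  have "x \<in> partial_sums (a # \<alpha>) \<longleftrightarrow> x = a \<or> x \<in> (+) a ` partial_sums \<alpha>" for x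
  proof
    assume "x \<in> partial_sums (a # \<alpha>)"
    then obtain j where j: "1 \<le> j" "j < Suc (length \<alpha>)" "x = sum_list (take j (a # \<alpha>))"
      by (auto simp: partial_sums_def)
    then obtain i where i: "j = Suc i" by (cases j) auto
    show "x = a \<or> x \<in> (+) a ` partial_sums \<alpha>"
    proof (cases "i = 0")
      case False
      then have "sum_list (take i \<alpha>) \<in> partial_sums \<alpha>"
        unfolding partial_sums_def using j(2) i by (intro CollectI exI[of _ i]) auto
      then show ?thesis using j i by auto
    qed (use j i in auto)
  next
    assume "x = a \<or> x \<in> (+) a ` partial_sums \<alpha>"
    then show "x \<in> partial_sums (a # \<alpha>)"
    proof
      assume "x = a"
      then show ?thesis using False by (auto simp: partial_sums_def intro!: exI[of _ 1])
    next
      assume "x \<in> (+) a ` partial_sums \<alpha>"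
      then obtain i where "1 \<le> i" "i < length \<alpha>" "x = a + sum_list (take i \<alpha>)"
        by (auto simp: partial_sums_def)
      then show ?thesis by (auto simp: partial_sums_def intro!: exI[of _ "Suc i"])
    qed
  qed
  with False show ?thesis by auto
qed

lemma partial_sums_subset: "is_comp \<alpha> \<Longrightarrow> partial_sums \<alpha> \<subseteq> {1..<sum_list \<alpha>}"
proof (induction \<alpha>)
  case (Cons a \<alpha>)
  then have "0 < sum_list \<alpha>" if "\<alpha> \<noteq> []"
    using that by (cases \<alpha>) auto
  with Cons show ?case by (auto simp: partial_sums_Cons)
qed auto

lemma partial_sums_append:
  "partial_sums (\<alpha> @ \<beta>) = partial_sums \<alpha> \<union> (if \<alpha> = [] \<or> \<beta> = [] then {} else {sum_list \<alpha>})
     \<union> (+) (sum_list \<alpha>) ` partial_sums \<beta>"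
proof (induction \<alpha>)
  case (Cons a \<alpha>)
  show ?case
  proof (cases "\<alpha> = []")
    case False
    then have "partial_sums ((a # \<alpha>) @ \<beta>) = insert a ((+) a ` partial_sums (\<alpha> @ \<beta>))"
      by (simp add: partial_sums_Cons)
    then show ?thesis
      using False unfolding Cons by (auto simp: partial_sums_Cons image_Un image_image add.assoc)
  qed (auto simp: partial_sums_Cons)
qed auto

text \<open>The first part of a composition with at least two parts is its least partial sum, so it
  can be read off and cancelled; the rest follows by induction.\<close>

lemma inj_on_partial_sums: "inj_on partial_sums (Comp n)"
proof (rule inj_onI)
  show "\<alpha> = \<beta>" if "\<alpha> \<in> Comp n" "\<beta> \<in> Comp n" "partial_sums \<alpha> = partial_sums \<beta>" for \<alpha> \<beta>
    using that
  proof (induction \<alpha> arbitrary: \<beta> n)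
    case Nil
    then show ?case by (cases \<beta>) (auto simp: Comp_def)
  next
    case (Cons a \<alpha>)
    then obtain b \<gamma> where \<beta>: "\<beta> = b # \<gamma>" by (cases \<beta>) (auto simp: Comp_def)
    have nonempty: "\<alpha> = [] \<longleftrightarrow> \<gamma> = []"
      using Cons.prems(3) by (auto simp: \<beta> partial_sums_Cons split: if_splits)
    show ?case
    proof (cases "\<alpha> = []")
      case True
      then show ?thesis using nonempty Cons.prems by (auto simp: \<beta> Comp_def)
    next
      case False
      have eq: "insert a ((+) a ` partial_sums \<alpha>) = insert b ((+) b ` partial_sums \<gamma>)"
        using Cons.prems(3) False nonempty by (auto simp: \<beta> partial_sums_Cons)
      have pos: "0 \<notin> partial_sums \<alpha>" "0 \<notin> partial_sums \<gamma>"
        using Cons.prems partial_sums_subset[of \<alpha>] partial_sums_subset[of \<gamma>]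
        by (auto simp: Comp_def \<beta>)
      \<comment> \<open>Each of \<open>a\<close> and \<open>b\<close> is at least the other.\<close>
      have "a \<in> insert b ((+) b ` partial_sums \<gamma>)" "b \<in> insert a ((+) a ` partial_sums \<alpha>)"
        using eq by blast+
      then have ab: "a = b" by auto
      \<comment> \<open>As 0 is no partial sum, \<open>a\<close> lies in neither translate and can
        be removed from both sides.\<close>
      have "(+) a ` partial_sums \<alpha> = (+) a ` partial_sums \<gamma>"
        using eq pos unfolding ab by (auto simp: insert_eq_iff image_iff)
      then have "partial_sums \<alpha> = partial_sums \<gamma>"
        by (simp add: inj_image_eq_iff)
      moreover have "\<alpha> \<in> Comp (n - a)" "\<gamma> \<in> Comp (n - a)"
        using Cons.prems by (auto simp: Comp_def \<beta> ab)
      ultimately show ?thesis using Cons.IH ab \<beta> by blast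
    qed
  qed
qed

text \<open>Strong induction on \<open>n\<close>: the minimum of \<open>D\<close> becomes the first
  part, and the remaining elements, translated down by it, give the other parts.\<close>

lemma partial_sums_surj:
  assumes "D \<subseteq> {1..<n}"
  shows "\<exists>\<alpha>\<in>Comp n. partial_sums \<alpha> = D"
  using assms
proof (induction n arbitrary: D rule: less_induct)
  case (less n)
  show ?case
  proof (cases "D = {}")
    case True
    then show ?thesis
      by (intro bexI[of _ "single_comp n"])
        (auto simp: single_comp_def Comp_def partial_sums_Cons)
  next
    case False
    have fin: "finite D" using less.prems by (rule finite_subset) auto
    define b where "b = Min D"
    have b: "b \<in> D" and b_le: "\<And>d. d \<in> D \<Longrightarrow> b \<le> d"
      unfolding b_def using fin False by auto
    then have bn: "0 < b" "b < n" using less.prems by auto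
    define D' where "D' = {d. 0 < d \<and> b + d \<in> D}"
    have "D' \<subseteq> {1..<n - b}" using less.prems by (auto simp: D'_def)
    then obtain \<alpha> where \<alpha>: "\<alpha> \<in> Comp (n - b)" "partial_sums \<alpha> = D'"
      using less.IH[of "n - b"] bn by auto
    have D: "D = insert b ((+) b ` D')"
    proof -
      have "d = b \<or> d \<in> (+) b ` D'" if "d \<in> D" for d
        using that b_le[OF that] by (auto simp: D'_def intro!: image_eqI[of _ _ "d - b"])
      then show ?thesis using b by (auto simp: D'_def)
    qed
    have "\<alpha> \<noteq> []" using \<alpha>(1) bn by (auto simp: Comp_def)
    then have "b # \<alpha> \<in> Comp n" "partial_sums (b # \<alpha>) = D"
      using \<alpha> bn D by (auto simp: Comp_def partial_sums_Cons)
    then show ?thesis by blast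
  qed
qed

text \<open>This makes \<open>co n\<close>, defined through \<open>the_inv_into\<close>, a two-sided
  inverse on the subsets of \<open>{1..<n}\<close>.\<close>

lemma bij_betw_partial_sums: "bij_betw partial_sums (Comp n) (Pow {1..<n})"
proof -
  have "partial_sums ` Comp n \<subseteq> Pow {1..<n}"
    using partial_sums_subset by (fastforce simp: Comp_def)
  moreover have "Pow {1..<n} \<subseteq> partial_sums ` Comp n"
    using partial_sums_surj by blast
  ultimately show ?thesis
    using inj_on_partial_sums by (auto simp: bij_betw_def)
qed

lemma co_in_Comp [intro]: "D \<subseteq> {1..<n} \<Longrightarrow> co n D \<in> Comp n"
  unfolding co_def
  using bij_betw_partial_sums[of n] by (intro the_inv_into_into) (auto simp: bij_betw_def)

lemma partial_sums_co [simp]: "D \<subseteq> {1..<n} \<Longrightarrow> partial_sums (co n D) = D"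
  unfolding co_def
  using bij_betw_partial_sums[of n] by (intro f_the_inv_into_f) (auto simp: bij_betw_def)

lemma co_eq_iff: "D \<subseteq> {1..<n} \<Longrightarrow> \<beta> \<in> Comp n \<Longrightarrow> co n D = \<beta> \<longleftrightarrow> D = partial_sums \<beta>"
  by (metis co_in_Comp inj_onD inj_on_partial_sums partial_sums_co)

lemma finite_Comp [simp]: "finite (Comp n)"
  using bij_betw_finite[OF bij_betw_partial_sums] by simp

lemma single_comp_in_Comp [simp]: "single_comp n \<in> Comp n"
  by (auto simp: single_comp_def Comp_def)

lemma partial_sums_single_comp [simp]: "partial_sums (single_comp n) = {}"
  by (auto simp: single_comp_def partial_sums_Cons)

section \<open>Descent sets of words and their behaviour under cutting\<close>

definition descents :: "real list \<Rightarrow> nat set" where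
  "descents w = {i. 1 \<le> i \<and> i < length w \<and> w ! (i - 1) > w ! i}"

lemma desc_comp_eq: "desc_comp w = co (length w) (descents w)"
  by (simp add: desc_comp_def descents_def)

lemma descents_subset: "descents w \<subseteq> {1..<length w}"
  by (auto simp: descents_def)

lemma desc_comp_in_Comp: "desc_comp w \<in> Comp (length w)"
  unfolding desc_comp_eq by (rule co_in_Comp[OF descents_subset])

lemma sum_list_desc_comp [simp]: "sum_list (desc_comp w) = length w"
  using desc_comp_in_Comp[of w] by (simp add: Comp_def)

lemma partial_sums_desc_comp [simp]: "partial_sums (desc_comp w) = descents w"
  unfolding desc_comp_eq by (rule partial_sums_co[OF descents_subset])

lemma desc_comp_eq_iff:
  "\<beta> \<in> Comp (length w) \<Longrightarrow> desc_comp w = \<beta> \<longleftrightarrow> descents w = partial_sums \<beta>"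
  unfolding desc_comp_eq by (rule co_eq_iff[OF descents_subset])

text \<open>A descent exactly at the cut is always permitted by \<open>\<alpha> @ \<beta>\<close>,
  and every other descent lies inside one of the two pieces.\<close>

lemma descents_split:
  assumes "is_comp \<alpha>" "is_comp \<beta>" "length w = sum_list \<alpha> + sum_list \<beta>"
  shows "descents w \<subseteq> partial_sums (\<alpha> @ \<beta>) \<longleftrightarrow>
    descents (take (sum_list \<alpha>) w) \<subseteq> partial_sums \<alpha> \<and>
    descents (drop (sum_list \<alpha>) w) \<subseteq> partial_sums \<beta>"
proof -
  define a where "a = sum_list \<alpha>"
  have t: "i \<in> descents (take a w) \<longleftrightarrow> i \<in> descents w \<and> i < a" for i
    using assms(3) by (auto simp: descents_def a_def)
  have d: "i \<in> descents (drop a w) \<longleftrightarrow> 0 < i \<and> a + i \<in> descents w" for i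
    using assms(3) by (auto simp: descents_def a_def)
  have mem: "x \<in> partial_sums (\<alpha> @ \<beta>) \<longleftrightarrow>
      (if x < a then x \<in> partial_sums \<alpha> else x = a \<or> x - a \<in> partial_sums \<beta>)"
    if "x \<in> descents w" for x
  proof -
    have x: "0 < x" "x < length w" using that by (auto simp: descents_def)
    have a: "partial_sums \<alpha> \<subseteq> {1..<a}" "partial_sums \<beta> \<subseteq> {1..<sum_list \<beta>}"
      using partial_sums_subset assms by (auto simp: a_def)
    consider "x < a" | "x = a" | "x > a" by linarith
    then show ?thesis
    proof cases
      \<comment> \<open>A descent at \<open>a\<close> lies strictly between 0 and the length of
        \<open>w\<close>, so neither factor is empty; only then is \<open>a\<close> a partial sum of
        the concatenation.\<close>
      case 2
      then have "\<alpha> \<noteq> []" "\<beta> \<noteq> []" using x assms(3) by (auto simp: a_def)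
      with 2 show ?thesis by (simp add: partial_sums_append a_def)
    next
      case 3
      then have "x \<in> (+) a ` partial_sums \<beta> \<longleftrightarrow> x - a \<in> partial_sums \<beta>"
        by (auto intro!: image_eqI[of _ _ "x - a"])
      with 3 a show ?thesis by (auto simp: partial_sums_append a_def)
    qed (use a in \<open>auto simp: partial_sums_append a_def\<close>)
  qed
  show ?thesis
  proof (intro iffI conjI)
    assume *: "descents w \<subseteq> partial_sums (\<alpha> @ \<beta>)"
    show "descents (take (sum_list \<alpha>) w) \<subseteq> partial_sums \<alpha>"
      using * mem t unfolding a_def[symmetric] by (metis subset_iff)
    show "descents (drop (sum_list \<alpha>) w) \<subseteq> partial_sums \<beta>"
      using * mem d unfolding a_def[symmetric]
      by (metis add_diff_cancel_left' add_eq_self_zero not_add_less1 not_gr_zero subset_iff)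
  next
    assume *: "descents (take (sum_list \<alpha>) w) \<subseteq> partial_sums \<alpha> \<and>
      descents (drop (sum_list \<alpha>) w) \<subseteq> partial_sums \<beta>"
    show "descents w \<subseteq> partial_sums (\<alpha> @ \<beta>)"
    proof
      fix x assume x: "x \<in> descents w"
      show "x \<in> partial_sums (\<alpha> @ \<beta>)"
        unfolding mem[OF x] using * t[of x] d[of "x - a"] x by (auto simp: a_def)
    qed
  qed
qed

section \<open>Shifted words and standardisation\<close>

text \<open>The modulus \<open>N\<close> is a parameter independent of
  the length, so that prefixes and suffixes of shifted words are again shifted words.\<close>

definition shift_word :: "nat \<Rightarrow> real list \<Rightarrow> nat list \<Rightarrow> real list" where
  "shift_word N u ds = map2 (\<lambda>s d. s + real (d * N)) u ds"

lemma length_shift_word [simp]: "length (shift_word N u ds) = min (length u) (length ds)"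
  by (simp add: shift_word_def)

lemma take_shift_word: "take k (shift_word N u ds) = shift_word N (take k u) (take k ds)"
  by (simp add: shift_word_def take_map take_zip)

lemma drop_shift_word: "drop k (shift_word N u ds) = shift_word N (drop k u) (drop k ds)"
  by (simp add: shift_word_def drop_map drop_zip)

text \<open>Letters lie in the half-open interval from 0 to \<open>N\<close>, so a larger shift
  outweighs any difference of letters. Shifted letters are therefore compared lexicographically, by
  shift first.\<close>

lemma descents_shift_word_iff:
  assumes "set u \<subseteq> {0<..real N}" "length ds = length u"
  shows "i \<in> descents (shift_word N u ds) \<longleftrightarrow> 1 \<le> i \<and> i < length u \<and>
    (ds ! i < ds ! (i - 1) \<or> ds ! (i - 1) = ds ! i \<and> i \<in> descents u)"
proof (cases "1 \<le> i \<and> i < length u")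
  case True
  have bounds: "0 < u ! j" "u ! j \<le> real N" if "j < length u" for j
    using assms(1) that nth_mem by fastforce+
  have nths: "shift_word N u ds ! j = u ! j + real (ds ! j * N)" if "j < length u" for j
    using that assms(2) by (simp add: shift_word_def)
  have less: "u ! j + real (ds ! j * N) < u ! k + real (ds ! k * N)"
    if "ds ! j < ds ! k" "j < length u" "k < length u" for j k
  proof -
    have "(ds ! j + 1) * N \<le> ds ! k * N"
      using that(1) by (intro mult_right_mono) auto
    then have "real (ds ! j * N) + real N \<le> real (ds ! k * N)"
      by (simp flip: of_nat_add of_nat_mult add: algebra_simps)
    then show ?thesis using bounds that by fastforce
  qed
  have "i \<in> descents (shift_word N u ds) \<longleftrightarrow>
      u ! i + real (ds ! i * N) < u ! (i - 1) + real (ds ! (i - 1) * N)"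
    using True nths[of i] nths[of "i - 1"] assms(2) by (auto simp: descents_def)
  moreover have "i \<in> descents u \<longleftrightarrow> u ! i < u ! (i - 1)"
    using True by (auto simp: descents_def)
  moreover have "i - 1 < length u" using True by linarith
  ultimately show ?thesis
    using True less[of i "i - 1"] less[of "i - 1" i]
    by (cases "ds ! i" "ds ! (i - 1)" rule: linorder_cases) auto
qed (use assms in \<open>auto simp: descents_def\<close>)

lemma length_word [simp]: "length (word n v) = n"
  by (simp add: word_def)

lemma word_nth: "1 \<le> i \<Longrightarrow> i \<le> n \<Longrightarrow> word n v ! (i - Suc 0) = real (v i)"
  using nth_map_upt[of "i - 1" "n + 1" 1 "\<lambda>i. real (v i)"] by (simp add: word_def del: upt_Suc)

lemma word_eq_shift_word: "word n (\<lambda>i. \<sigma> i + d i * n) = shift_word n (word n \<sigma>) (map d [1..<n + 1])"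
  by (rule nth_equalityI) (auto simp: word_def shift_word_def simp del: upt_Suc)

lemma set_word_permutes:
  assumes "\<sigma> permutes {1..n}" shows "set (word n \<sigma>) \<subseteq> {0<..real n}"
proof
  fix x assume "x \<in> set (word n \<sigma>)"
  then obtain i where "i \<in> {1..n}" "x = real (\<sigma> i)"
    by (force simp: word_def simp del: upt_Suc)
  then show "x \<in> {0<..real n}" using permutes_in_image[OF assms, of i] by simp
qed

text \<open>Injectivity excludes equal neighbours, so a word without descents increases strictly
  from each position to the next, hence across any distance.\<close>

lemma descents_word_empty_iff:
  assumes "inj_on v {1..n}"
  shows "descents (word n v) = {} \<longleftrightarrow> (\<forall>i\<in>{1..n}. \<forall>j\<in>{1..n}. v i < v j \<longleftrightarrow> i < j)"
proof
  assume empty: "descents (word n v) = {}"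
  have step: "v i < v (Suc i)" if "1 \<le> i" "i < n" for i
  proof -
    have "i \<notin> descents (word n v)" using empty by simp
    then have "v i \<le> v (Suc i)"
      using that word_nth[of i n v] word_nth[of "Suc i" n v] by (auto simp: descents_def)
    moreover have "v i \<noteq> v (Suc i)" using inj_onD[OF assms, of i "Suc i"] that by auto
    ultimately show ?thesis by simp
  qed
  have mono: "v i < v j" if "1 \<le> i" "i < j" "j \<le> n" for i j
    using that(2,3)
  proof (induction j)
    case (Suc j)
    then show ?case using step[of j] that(1) by (cases "i = j") auto
  qed simp
  show "\<forall>i\<in>{1..n}. \<forall>j\<in>{1..n}. v i < v j \<longleftrightarrow> i < j"
  proof (intro ballI)
    fix i j assume "i \<in> {1..n}" "j \<in> {1..n}"
    then show "v i < v j \<longleftrightarrow> i < j"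
      using mono[of i j] mono[of j i] by (cases i j rule: linorder_cases) auto
  qed
next
  assume mono: "\<forall>i\<in>{1..n}. \<forall>j\<in>{1..n}. v i < v j \<longleftrightarrow> i < j"
  have "\<not> v (Suc i) < v i" if "1 \<le> i" "i < n" for i
    using mono that by simp
  then have "i \<notin> descents (word n v)" for i
    using word_nth[of i n v] word_nth[of "Suc i" n v] by (auto simp: descents_def)
  then show "descents (word n v) = {}" by blast
qed

text \<open>Makes the definite description in \<open>st\<close> meaningful. The permutation is the
  rank function, counting the \<open>k\<close> with \<open>v k \<le> v i\<close>.\<close>

lemma standardization_unique:
  fixes v :: "nat \<Rightarrow> nat"
  assumes "inj_on v {1..n}"
  shows "\<exists>!\<tau>. \<tau> permutes {1..n} \<and> (\<forall>i\<in>{1..n}. \<forall>j\<in>{1..n}. v i < v j \<longleftrightarrow> \<tau> i < \<tau> j)"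
proof (rule ex_ex1I)
  define R where "R i = {k\<in>{1..n}. v k \<le> v i}" for i
  \<comment> \<open>Outside \<open>{1..n}\<close> the identity is chosen because
    \<open>permutes\<close> demands fixed points there.\<close>
  define \<tau> where "\<tau> i = (if i \<in> {1..n} then card (R i) else i)" for i
  have fin: "finite (R i)" for i by (auto simp: R_def)
  have less: "\<tau> i < \<tau> j" if "i \<in> {1..n}" "j \<in> {1..n}" "v i < v j" for i j
  proof -
    have "R i \<subseteq> R j" "j \<in> R j" "j \<notin> R i" using that by (auto simp: R_def)
    then have "R i \<subset> R j" by blast
    then show ?thesis using that fin by (auto simp: \<tau>_def intro: psubset_card_mono)
  qed
  have iff: "v i < v j \<longleftrightarrow> \<tau> i < \<tau> j" if "i \<in> {1..n}" "j \<in> {1..n}" for i j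
    using less[OF that] less[OF that(2,1)] inj_onD[OF assms _ that]
    by (cases "v i" "v j" rule: linorder_cases) auto
  have inj: "inj_on \<tau> {1..n}"
    by (rule inj_onI) (metis assms iff inj_onD less_irrefl nat_neq_iff)
  have "\<tau> ` {1..n} \<subseteq> {1..n}"
  proof safe
    fix i assume i: "i \<in> {1..n}"
    have "card {i} \<le> card (R i)" using i fin by (intro card_mono) (auto simp: R_def)
    moreover have "card (R i) \<le> card {1..n}" by (intro card_mono) (auto simp: R_def)
    ultimately show "\<tau> i \<in> {1..n}" using i by (auto simp: \<tau>_def)
  qed
  then have "bij_betw \<tau> {1..n} {1..n}"
    using inj by (simp add: bij_betw_def endo_inj_surj)
  then have "\<tau> permutes {1..n}"
    by (rule bij_imp_permutes) (unfold \<tau>_def, rule if_not_P)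
  then show "\<exists>\<tau>. \<tau> permutes {1..n} \<and> (\<forall>i\<in>{1..n}. \<forall>j\<in>{1..n}. v i < v j \<longleftrightarrow> \<tau> i < \<tau> j)"
    using iff by blast
next
  \<comment> \<open>Any solution is forced to be the rank: it carries the positions of value at most
    \<open>v i\<close> bijectively onto \<open>{1..\<tau> i}\<close>.\<close>
  have rank: "\<tau> i = card {k\<in>{1..n}. v k \<le> v i}"
    if \<tau>: "\<tau> permutes {1..n}" "\<forall>i\<in>{1..n}. \<forall>j\<in>{1..n}. v i < v j \<longleftrightarrow> \<tau> i < \<tau> j" "i \<in> {1..n}"
    for \<tau> i
  proof -
    have "\<tau> ` {k\<in>{1..n}. \<tau> k \<le> \<tau> i} = {1..\<tau> i}"
    proof (intro equalityI subsetI)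
      fix x assume x: "x \<in> {1..\<tau> i}"
      have "\<tau> i \<in> {1..n}" using permutes_in_image[OF \<tau>(1)] \<tau>(3) by blast
      then have "x \<in> {1..n}" using x by auto
      then obtain k where "k \<in> {1..n}" "x = \<tau> k" using permutes_image[OF \<tau>(1)] by blast
      then show "x \<in> \<tau> ` {k\<in>{1..n}. \<tau> k \<le> \<tau> i}" using x by auto
    qed (use permutes_in_image[OF \<tau>(1)] in auto)
    moreover have "{k\<in>{1..n}. v k \<le> v i} = {k\<in>{1..n}. \<tau> k \<le> \<tau> i}"
      using \<tau>(2,3) by (auto simp: not_less[symmetric])
    moreover have "card (\<tau> ` {k\<in>{1..n}. \<tau> k \<le> \<tau> i}) = card {k\<in>{1..n}. \<tau> k \<le> \<tau> i}"
      by (intro card_image inj_on_subset[OF permutes_inj_on[OF \<tau>(1), of UNIV]]) auto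
    ultimately show ?thesis by simp
  qed
  fix \<tau> \<tau>'
  assume *: "\<tau> permutes {1..n} \<and> (\<forall>i\<in>{1..n}. \<forall>j\<in>{1..n}. v i < v j \<longleftrightarrow> \<tau> i < \<tau> j)"
    "\<tau>' permutes {1..n} \<and> (\<forall>i\<in>{1..n}. \<forall>j\<in>{1..n}. v i < v j \<longleftrightarrow> \<tau>' i < \<tau>' j)"
  have "\<tau> i = \<tau>' i" for i
  proof (cases "i \<in> {1..n}")
    case True
    then show ?thesis using rank[of \<tau> i] rank[of \<tau>' i] * by simp
  next
    case False
    then show ?thesis using * permutes_not_in by metis
  qed
  then show "\<tau> = \<tau>'" by blast
qed

lemma st_word:
  assumes "inj_on v {1..n}"
  shows st_word_permutes: "st (word n v) permutes {1..n}"
    and st_word_eq_iff: "\<tau> permutes {1..n} \<Longrightarrow>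
      st (word n v) = \<tau> \<longleftrightarrow> descents (word n (v \<circ> inv \<tau>)) = {}"
proof -
  let ?P = "\<lambda>\<tau>. \<tau> permutes {1..n} \<and> (\<forall>i\<in>{1..n}. \<forall>j\<in>{1..n}. v i < v j \<longleftrightarrow> \<tau> i < \<tau> j)"
  have st: "st (word n v) = (THE \<tau>. ?P \<tau>)"
    unfolding st_def length_word
    by (intro arg_cong[of _ _ The] ext conj_cong ball_cong refl) (auto simp: word_nth)
  have P: "?P (st (word n v))"
    unfolding st by (rule theI'[OF standardization_unique[OF assms]])
  then show "st (word n v) permutes {1..n}" by blast
  assume \<tau>: "\<tau> permutes {1..n}"
  note inv = permutes_inv[OF \<tau>]
  have "inj_on (v \<circ> inv \<tau>) {1..n}"
    using assms permutes_inj_on[OF inv, of "{1..n}"] permutes_image[OF inv]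
    by (intro comp_inj_on) simp_all
  then have "descents (word n (v \<circ> inv \<tau>)) = {} \<longleftrightarrow>
      (\<forall>i\<in>{1..n}. \<forall>j\<in>{1..n}. v (inv \<tau> i) < v (inv \<tau> j) \<longleftrightarrow> i < j)"
    by (simp add: descents_word_empty_iff)
  \<comment> \<open>Substituting values of \<tau> for the bound variables turns increase of
    \<open>v \<circ> inv \<tau>\<close> into the condition that \<tau> orders positions as
    \<open>v\<close> does.\<close>
  also have "\<dots> \<longleftrightarrow> (\<forall>i\<in>\<tau> ` {1..n}. \<forall>j\<in>\<tau> ` {1..n}. v (inv \<tau> i) < v (inv \<tau> j) \<longleftrightarrow> i < j)"
    by (simp only: permutes_image[OF \<tau>])
  also have "\<dots> \<longleftrightarrow> (\<forall>i\<in>{1..n}. \<forall>j\<in>{1..n}. v i < v j \<longleftrightarrow> \<tau> i < \<tau> j)"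
    by (simp add: permutes_inverses(2)[OF \<tau>])
  also have "\<dots> \<longleftrightarrow> st (word n v) = \<tau>"
    using P \<tau> standardization_unique[OF assms] by blast
  finally show "st (word n v) = \<tau> \<longleftrightarrow> descents (word n (v \<circ> inv \<tau>)) = {}" by blast
qed

section \<open>Run lengths\<close>

text \<open>For strictly increasing \<open>js\<close> the results correspond to the monomials of
  \<open>QM \<gamma>\<close>: a run of \<open>\<gamma> ! j\<close> copies of \<open>js ! j\<close>
  stands for a power of one variable.\<close>

definition run_length_decode :: "nat list \<Rightarrow> nat list \<Rightarrow> nat list" where
  "run_length_decode \<gamma> js = concat (map2 replicate \<gamma> js)"

lemma run_length_decode_simps [simp]:
  "run_length_decode [] [] = []"
  "run_length_decode (c # \<gamma>) (j # js) = replicate c j @ run_length_decode \<gamma> js"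
  by (simp_all add: run_length_decode_def)

lemma length_run_length_decode:
  "length js = length \<gamma> \<Longrightarrow> length (run_length_decode \<gamma> js) = sum_list \<gamma>"
  by (induction js \<gamma> rule: list_induct2) auto

lemma set_run_length_decode:
  "length js = length \<gamma> \<Longrightarrow> is_comp \<gamma> \<Longrightarrow> set (run_length_decode \<gamma> js) = set js"
  by (induction js \<gamma> rule: list_induct2) auto

text \<open>The first run is the longest constant prefix, since strict increase keeps
  \<open>j\<close> out of the later runs; positive lengths ensure that no run is invisible.\<close>

lemma run_length_decode_inj:
  assumes "length js = length \<gamma>" "is_comp \<gamma>" "sorted_wrt (<) js"
    "length ks = length \<beta>" "is_comp \<beta>" "sorted_wrt (<) ks"
    "run_length_decode \<gamma> js = run_length_decode \<beta> ks"
  shows "\<gamma> = \<beta> \<and> js = ks"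
  using assms
proof (induction js \<gamma> arbitrary: ks \<beta> rule: list_induct2)
  case Nil
  then show ?case by (cases ks; cases \<beta>) auto
next
  case (Cons j js c \<gamma>)
  then obtain k ks' b \<beta>' where eq: "ks = k # ks'" "\<beta> = b # \<beta>'"
    by (cases ks; cases \<beta>) auto
  have "hd (run_length_decode (c # \<gamma>) (j # js)) = j" "hd (run_length_decode \<beta> ks) = k"
    using Cons.prems eq by (cases c; cases b; simp)+
  then have k: "k = j" using Cons.prems by simp
  have tw: "takeWhile ((=) j) (replicate a j @ xs) = replicate a j"
    if "j \<notin> set xs" for a and xs :: "nat list"
  proof -
    have "takeWhile ((=) j) xs = []" using that by (cases xs) auto
    then show ?thesis by (simp add: takeWhile_append)
  qed
  have "j \<notin> set (run_length_decode \<gamma> js)" "j \<notin> set (run_length_decode \<beta>' ks')"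
    using Cons.prems Cons.hyps eq k by (auto simp: set_run_length_decode)
  then have "replicate c j = replicate b j"
    using Cons.prems(6) eq k tw by (metis run_length_decode_simps(2))
  then have c: "c = b" by (metis length_replicate)
  then have "\<gamma> = \<beta>' \<and> js = ks'"
    using Cons.prems eq k by (intro Cons.IH) auto
  then show ?case using c k eq by simp
qed

text \<open>A new first letter either lengthens the first run or, being smaller, starts a run of
  length 1.\<close>

lemma run_length_decode_surj:
  assumes "sorted ds"
  shows "\<exists>\<gamma> js. length js = length \<gamma> \<and> is_comp \<gamma> \<and> sorted_wrt (<) js \<and> ds = run_length_decode \<gamma> js"
  using assms
proof (induction ds)
  case Nil
  show ?case by (rule exI[of _ "[]"], rule exI[of _ "[]"]) simp
next
  case (Cons d ds)
  then obtain \<gamma> js where IH: "length js = length \<gamma>" "is_comp \<gamma>" "sorted_wrt (<) js"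
    "ds = run_length_decode \<gamma> js" by auto
  then have le: "d \<le> x" if "x \<in> set js" for x
    using Cons.prems that by (auto simp: set_run_length_decode)
  show ?case
  proof (cases js)
    case Nil
    with IH show ?thesis by (intro exI[of _ "[1]"] exI[of _ "[d]"]) auto
  next
    case (Cons j js')
    then obtain c \<gamma>' where \<gamma>: "\<gamma> = c # \<gamma>'" using IH(1) by (cases \<gamma>) auto
    show ?thesis
    proof (cases "d = j")
      case True
      with IH Cons \<gamma> show ?thesis by (intro exI[of _ "Suc c # \<gamma>'"] exI[of _ "js"]) auto
    next
      case False
      with le Cons have "d < j" by force
      with IH Cons \<gamma> show ?thesis by (intro exI[of _ "1 # \<gamma>"] exI[of _ "d # js"]) auto
    qed
  qed
qed

text \<open>List indices start at 0, so a partial sum \<open>i\<close> is the index of the first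
  entry of a new run, and \<open>i - 1\<close> that of the last entry of the preceding one.\<close>

lemma run_length_decode_step:
  assumes "length js = length \<gamma>" "is_comp \<gamma>" "sorted_wrt (<) js" "1 \<le> i" "i < sum_list \<gamma>"
  shows "if i \<in> partial_sums \<gamma>
    then run_length_decode \<gamma> js ! (i - 1) < run_length_decode \<gamma> js ! i
    else run_length_decode \<gamma> js ! (i - 1) = run_length_decode \<gamma> js ! i"
  using assms
proof (induction js \<gamma> arbitrary: i rule: list_induct2)
  case (Cons j js c \<gamma>)
  have S: "partial_sums \<gamma> \<subseteq> {1..<sum_list \<gamma>}" using Cons.prems by (intro partial_sums_subset) simp
  have len: "length (run_length_decode \<gamma> js) = sum_list \<gamma>"
    using Cons.hyps by (rule length_run_length_decode)
  consider "i < c" | "i = c" | "c < i" by linarith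
  then show ?case
  proof cases
    case 1
    then show ?thesis using S by (auto simp: partial_sums_Cons nth_append)
  next
    case 2
    then have "\<gamma> \<noteq> []" "run_length_decode \<gamma> js ! 0 \<in> set (run_length_decode \<gamma> js)"
      using Cons.prems len by (auto intro!: nth_mem)
    then have "\<gamma> \<noteq> []" "j < run_length_decode \<gamma> js ! 0"
      using Cons.prems Cons.hyps by (auto simp: set_run_length_decode)
    then show ?thesis using 2 Cons.prems by (auto simp: partial_sums_Cons nth_append)
  next
    case 3
    then have "\<gamma> \<noteq> []" using Cons.prems by auto
    moreover have "i \<in> (+) c ` partial_sums \<gamma> \<longleftrightarrow> i - c \<in> partial_sums \<gamma>"
      using 3 by (auto intro!: image_eqI[of _ _ "i - c"])
    moreover have "if i - c \<in> partial_sums \<gamma>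
      then run_length_decode \<gamma> js ! (i - c - 1) < run_length_decode \<gamma> js ! (i - c)
      else run_length_decode \<gamma> js ! (i - c - 1) = run_length_decode \<gamma> js ! (i - c)"
      using Cons.prems 3 by (intro Cons.IH) auto
    moreover have "i - 1 - c = i - c - 1" by simp
    ultimately show ?thesis
      using 3 by (auto simp: partial_sums_Cons nth_append)
  qed
qed simp

text \<open>Here \<open>\<gamma>\<close> records the lengths of the runs of equal shifts and \<open>js\<close> their values.\<close>

lemma no_descents_shift_word_iff:
  assumes u: "set u \<subseteq> {0<..real N}" and len: "length ds = length u"
  shows "descents (shift_word N u ds) = {} \<longleftrightarrow>
    (\<exists>\<gamma>\<in>Comp (length u). descents u \<subseteq> partial_sums \<gamma> \<and>
      (\<exists>js. length js = length \<gamma> \<and> sorted_wrt (<) js \<and> ds = run_length_decode \<gamma> js))"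
    (is "_ \<longleftrightarrow> ?R")
proof
  assume empty: "descents (shift_word N u ds) = {}"
  have "ds ! i \<le> ds ! Suc i" if "Suc i < length ds" for i
    using descents_shift_word_iff[OF u len, of "Suc i"] that len empty by auto
  then have "sorted ds" by (simp add: sorted_iff_nth_Suc)
  then obtain \<gamma> js where *: "length js = length \<gamma>" "is_comp \<gamma>" "sorted_wrt (<) js"
    "ds = run_length_decode \<gamma> js" using run_length_decode_surj by blast
  then have sum: "sum_list \<gamma> = length u" using len length_run_length_decode by metis
  \<comment> \<open>Inside a run the shifts agree, so a descent of \<open>u\<close> there would
    survive shifting.\<close>
  have "i \<in> partial_sums \<gamma>" if "i \<in> descents u" for i
  proof (rule ccontr)
    assume i: "i \<notin> partial_sums \<gamma>"
    have "1 \<le> i" "i < length u" using that by (auto simp: descents_def)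
    then have "i \<in> descents (shift_word N u ds)"
      using run_length_decode_step[OF *(1-3), of i] i sum that
      unfolding descents_shift_word_iff[OF u len] by (simp add: *(4))
    then show False using empty by simp
  qed
  then show ?R using * sum by (auto simp: Comp_def)
next
  assume ?R
  then obtain \<gamma> js where *: "\<gamma> \<in> Comp (length u)" "descents u \<subseteq> partial_sums \<gamma>"
    "length js = length \<gamma>" "sorted_wrt (<) js" "ds = run_length_decode \<gamma> js" by blast
  \<comment> \<open>At a run boundary the shift increases; elsewhere it is constant and
    \<open>u\<close> has no descent.\<close>
  have "i \<notin> descents (shift_word N u ds)" for i
    using run_length_decode_step[of js \<gamma> i] * unfolding descents_shift_word_iff[OF u len]
    by (auto simp: Comp_def split: if_splits)
  then show "descents (shift_word N u ds) = {}" by blast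
qed

section \<open>Quasisymmetric functions\<close>

lemma Comp_is_comp: "\<alpha> \<in> Comp n \<Longrightarrow> is_comp \<alpha>"
  by (simp add: Comp_def)

section \<open>Monomials as pairs of a strictly increasing index list and a composition\<close>

lemma lookup_mon:
  "Poly_Mapping.lookup (mon js \<alpha>) x = (\<Sum>j<length \<alpha>. if js ! j = x then \<alpha> ! j else 0)"
  by (auto simp: mon_def lookup_sum lookup_single when_def intro!: sum.cong)

lemma lookup_mon_nth:
  assumes "distinct js" "length js = length \<alpha>" "k < length \<alpha>"
  shows "Poly_Mapping.lookup (mon js \<alpha>) (js ! k) = \<alpha> ! k"
proof -
  have "Poly_Mapping.lookup (mon js \<alpha>) (js ! k) = (\<Sum>j<length \<alpha>. if j = k then \<alpha> ! j else 0)"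
    unfolding lookup_mon using assms by (intro sum.cong) (auto simp: nth_eq_iff_index_eq)
  then show ?thesis using assms by simp
qed

lemma keys_mon:
  assumes "distinct js" "length js = length \<alpha>" "is_comp \<alpha>"
  shows "Poly_Mapping.keys (mon js \<alpha>) = set js"
proof (intro equalityI subsetI)
  fix x assume "x \<in> Poly_Mapping.keys (mon js \<alpha>)"
  then have "(\<Sum>j<length \<alpha>. if js ! j = x then \<alpha> ! j else 0) \<noteq> 0"
    by (simp add: in_keys_iff lookup_mon)
  then obtain j where "j < length \<alpha>" "js ! j = x"
    by (auto elim!: sum.not_neutral_contains_not_neutral split: if_splits)
  then show "x \<in> set js" using assms(2) nth_mem by metis
next
  fix x assume "x \<in> set js"
  then obtain k where k: "k < length \<alpha>" "x = js ! k" using assms(2) by (metis in_set_conv_nth)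
  then have "0 < \<alpha> ! k" using assms(3) by (simp add: is_comp_def)
  then show "x \<in> Poly_Mapping.keys (mon js \<alpha>)"
    using lookup_mon_nth[OF assms(1,2) k(1)] k(2) by (simp add: in_keys_iff)
qed

text \<open>The support of the monomial, sorted, recovers the index list; the exponents are then its
  values.\<close>

lemma mon_inj:
  assumes "sorted_wrt (<) js" "length js = length \<alpha>" "is_comp \<alpha>"
    "sorted_wrt (<) ks" "length ks = length \<beta>" "is_comp \<beta>" "mon js \<alpha> = mon ks \<beta>"
  shows "js = ks \<and> \<alpha> = \<beta>"
proof -
  have dist: "distinct js" "distinct ks" using assms by (auto simp: strict_sorted_iff)
  then have "set js = set ks" using keys_mon assms by metis
  then have jk: "js = ks" using assms strict_sorted_equal by metis
  then have "\<alpha> = \<beta>"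
    using assms lookup_mon_nth[OF dist(1)] by (intro nth_equalityI) metis+
  with jk show ?thesis by blast
qed

lemma mon_surj:
  obtains js \<alpha> where "sorted_wrt (<) js" "length js = length \<alpha>" "is_comp \<alpha>" "m = mon js \<alpha>"
proof
  let ?js = "sorted_list_of_set (Poly_Mapping.keys m)"
  let ?\<alpha> = "map (Poly_Mapping.lookup m) ?js"
  show "sorted_wrt (<) ?js" by simp
  show len: "length ?js = length ?\<alpha>" by simp
  show comp: "is_comp ?\<alpha>" by (auto simp: is_comp_def in_keys_iff)
  show "m = mon ?js ?\<alpha>"
  proof (rule poly_mapping_eqI)
    fix x
    show "Poly_Mapping.lookup m x = Poly_Mapping.lookup (mon ?js ?\<alpha>) x"
    proof (cases "x \<in> Poly_Mapping.keys m")
      case True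
      then obtain k where k: "k < length ?js" "x = ?js ! k"
        by (metis finite_keys in_set_conv_nth set_sorted_list_of_set)
      then show ?thesis using lookup_mon_nth[of ?js ?\<alpha> k] by simp
    next
      case False
      then have "x \<notin> Poly_Mapping.keys (mon ?js ?\<alpha>)"
        using keys_mon[OF _ len comp] by simp
      then show ?thesis using False by (simp add: in_keys_iff)
    qed
  qed
qed

lemma prod_keys_mon:
  assumes "sorted_wrt (<) js" "length js = length \<alpha>" "is_comp \<alpha>"
  shows "(\<Prod>i\<in>Poly_Mapping.keys (mon js \<alpha>). h i (Poly_Mapping.lookup (mon js \<alpha>) i))
    = (\<Prod>j<length \<alpha>. h (js ! j) (\<alpha> ! j))"
proof -
  have dist: "distinct js" using assms by (auto simp: strict_sorted_iff)
  have "bij_betw ((!) js) {..<length \<alpha>} (set js)"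
    using dist assms(2) by (intro bij_betw_nth) auto
  then have "(\<Prod>i\<in>set js. h i (Poly_Mapping.lookup (mon js \<alpha>) i))
      = (\<Prod>j<length \<alpha>. h (js ! j) (Poly_Mapping.lookup (mon js \<alpha>) (js ! j)))"
    by (rule prod.reindex_bij_betw[symmetric])
  then show ?thesis
    using keys_mon[OF dist assms(2,3)] lookup_mon_nth[OF dist assms(2)] by simp
qed

lemma deg_mon:
  assumes "sorted_wrt (<) js" "length js = length \<alpha>" "is_comp \<alpha>"
  shows "deg (mon js \<alpha>) = sum_list \<alpha>"
proof -
  have dist: "distinct js" using assms by (auto simp: strict_sorted_iff)
  have "bij_betw ((!) js) {..<length \<alpha>} (set js)"
    using dist assms(2) by (intro bij_betw_nth) auto
  then have "(\<Sum>i\<in>set js. Poly_Mapping.lookup (mon js \<alpha>) i)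
      = (\<Sum>j<length \<alpha>. Poly_Mapping.lookup (mon js \<alpha>) (js ! j))"
    by (rule sum.reindex_bij_betw[symmetric])
  then show ?thesis
    using keys_mon[OF dist assms(2,3)] lookup_mon_nth[OF dist assms(2)]
    by (simp add: deg_def sum_list_sum_nth atLeast0LessThan)
qed

lemma deg_first_mon: "is_comp \<alpha> \<Longrightarrow> deg (first_mon \<alpha>) = sum_list \<alpha>"
  unfolding first_mon_def by (rule deg_mon) auto

section \<open>Quasisymmetric functions and their coefficients at first monomials\<close>

lemma QSym_mon:
  assumes "f \<in> QSym" "sorted_wrt (<) js" "length js = length \<alpha>" "is_comp \<alpha>"
  shows "f (mon js \<alpha>) = f (first_mon \<alpha>)"
proof -
  have "sorted_wrt (<) [0..<length \<alpha>]" "length [0..<length \<alpha>] = length \<alpha>" by simp_all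
  then show ?thesis using assms unfolding QSym_def first_mon_def by blast
qed

lemma QSymI:
  assumes "\<And>m. f m \<noteq> 0 \<Longrightarrow> deg m \<le> d"
    and "\<And>\<alpha> js. sorted_wrt (<) js \<Longrightarrow> length js = length \<alpha> \<Longrightarrow> is_comp \<alpha> \<Longrightarrow>
      f (mon js \<alpha>) = f (first_mon \<alpha>)"
  shows "f \<in> QSym"
  unfolding QSym_def using assms by auto

text \<open>Every monomial has the form \<open>mon js \<alpha>\<close>, and quasisymmetry moves its
  index list to the initial segment.\<close>

lemma QSym_eqI:
  assumes "f \<in> QSym" "g \<in> QSym" "\<And>\<alpha>. is_comp \<alpha> \<Longrightarrow> f (first_mon \<alpha>) = g (first_mon \<alpha>)"
  shows "f = g"
proof
  fix m
  obtain js \<alpha> where "sorted_wrt (<) js" "length js = length \<alpha>" "is_comp \<alpha>" "m = mon js \<alpha>"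
    by (rule mon_surj)
  then show "f m = g m" using assms QSym_mon by metis
qed

text \<open>Bounded degree leaves finitely many compositions. The sum in \<open>coprod\<close>
  ranges over this set, and a sum over an infinite set would default to 0.\<close>

lemma finite_QSym_support:
  assumes "f \<in> QSym"
  shows "finite {\<alpha>. is_comp \<alpha> \<and> f (first_mon \<alpha>) \<noteq> 0}"
proof -
  obtain d where "\<And>m. f m \<noteq> 0 \<Longrightarrow> deg m \<le> d" using assms by (auto simp: QSym_def)
  then have "{\<alpha>. is_comp \<alpha> \<and> f (first_mon \<alpha>) \<noteq> 0} \<subseteq> (\<Union>n\<le>d. Comp n)"
    using deg_first_mon by (force simp: Comp_def)
  then show ?thesis by (rule finite_subset) simp
qed

text \<open>By \<open>mon_inj\<close> the cardinality defining \<open>QM\<close> is 0 or 1.\<close>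

lemma QM_mon:
  assumes "sorted_wrt (<) js" "length js = length \<beta>" "is_comp \<beta>" "is_comp \<alpha>"
  shows "QM \<alpha> (mon js \<beta>) = of_bool (\<alpha> = \<beta>)"
proof -
  have "{ks. length ks = length \<alpha> \<and> sorted_wrt (<) ks \<and> mon ks \<alpha> = mon js \<beta>}
      = (if \<alpha> = \<beta> then {js} else {})"
    using mon_inj assms by (auto; metis)
  then show ?thesis by (simp add: QM_def)
qed

lemma QM_first_mon: "is_comp \<alpha> \<Longrightarrow> is_comp \<beta> \<Longrightarrow> QM \<alpha> (first_mon \<beta>) = of_bool (\<alpha> = \<beta>)"
  unfolding first_mon_def by (rule QM_mon) auto

lemma homogeneous_QM:
  assumes "is_comp \<alpha>" shows "homogeneous (sum_list \<alpha>) (QM \<alpha>)"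
  unfolding homogeneous_def
proof (intro allI impI)
  fix m assume m: "QM \<alpha> m \<noteq> 0"
  obtain js \<beta> where "sorted_wrt (<) js" "length js = length \<beta>" "is_comp \<beta>" "m = mon js \<beta>"
    by (rule mon_surj)
  with m assms show "deg m = sum_list \<alpha>" by (simp add: QM_mon deg_mon split: if_splits)
qed

lemma QM_in_QSym [intro]:
  assumes "is_comp \<alpha>" shows "QM \<alpha> \<in> QSym"
proof -
  have "\<exists>d. \<forall>m. QM \<alpha> m \<noteq> 0 \<longrightarrow> deg m \<le> d"
    using homogeneous_QM[OF assms] by (auto simp: homogeneous_def)
  then show ?thesis using assms by (auto simp: QSym_def QM_mon)
qed

lemma QSym_zero [intro]: "(\<lambda>m. 0) \<in> QSym"
  by (simp add: QSym_def)

lemma QSym_add: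
  assumes "f \<in> QSym" "g \<in> QSym" shows "(\<lambda>m. f m + g m) \<in> QSym"
proof -
  obtain d e where "\<And>m. f m \<noteq> 0 \<Longrightarrow> deg m \<le> d" "\<And>m. g m \<noteq> 0 \<Longrightarrow> deg m \<le> e"
    using assms by (auto simp: QSym_def)
  then have "f m + g m \<noteq> 0 \<Longrightarrow> deg m \<le> max d e" for m
    by (cases "f m = 0") (fastforce simp: le_max_iff_disj)+
  then show ?thesis using assms by (intro QSymI[of _ "max d e"]) (simp_all add: QSym_mon)
qed

lemma QSym_scale:
  assumes "f \<in> QSym" shows "(\<lambda>m. s * f m) \<in> QSym"
proof -
  obtain d where "\<And>m. f m \<noteq> 0 \<Longrightarrow> deg m \<le> d" using assms by (auto simp: QSym_def)
  then show ?thesis using assms by (intro QSymI[of _ d]) (simp_all add: QSym_mon)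
qed

lemma QSym_sum:
  assumes "finite B" "\<And>b. b \<in> B \<Longrightarrow> g b \<in> QSym"
  shows "(\<lambda>m. \<Sum>b\<in>B. c b * g b m) \<in> QSym"
  using assms by (induction B rule: finite_induct) (auto intro!: QSym_add QSym_scale)

text \<open>Indicator coefficients put \<open>QF\<close> in the form of a linear combination, to
  which \<open>QSym_sum\<close> and \<open>End_QSym_sum\<close> apply.\<close>

lemma QF_eq: "QF \<alpha> = (\<lambda>m. \<Sum>\<beta>\<in>Comp (sum_list \<alpha>).
    of_bool (partial_sums \<alpha> \<subseteq> partial_sums \<beta>) * QM \<beta> m)"
proof
  fix m
  have "{\<beta>\<in>Comp (sum_list \<alpha>). refines \<beta> \<alpha>}
      = {\<beta>\<in>Comp (sum_list \<alpha>). partial_sums \<alpha> \<subseteq> partial_sums \<beta>}"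
    by (auto simp: refines_def Comp_def)
  then show "QF \<alpha> m = (\<Sum>\<beta>\<in>Comp (sum_list \<alpha>).
      of_bool (partial_sums \<alpha> \<subseteq> partial_sums \<beta>) * QM \<beta> m)"
    unfolding QF_def by (simp add: sum.inter_filter of_bool_def if_distrib[of "\<lambda>x. x * _"] cong: if_cong)
qed

lemma QF_in_QSym [intro]: "QF \<alpha> \<in> QSym"
  unfolding QF_eq by (rule QSym_sum) (auto dest: Comp_is_comp)

lemma homogeneous_QF: "homogeneous (sum_list \<alpha>) (QF \<alpha>)"
  unfolding homogeneous_def
proof (intro allI impI)
  fix m assume "QF \<alpha> m \<noteq> 0"
  then obtain \<beta> where "\<beta> \<in> Comp (sum_list \<alpha>)" "QM \<beta> m \<noteq> 0"
    unfolding QF_eq by (auto elim!: sum.not_neutral_contains_not_neutral)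
  then show "deg m = sum_list \<alpha>"
    using homogeneous_QM[of \<beta>] by (auto simp: homogeneous_def Comp_def)
qed

lemma QF_first_mon:
  assumes "is_comp \<beta>"
  shows "QF \<alpha> (first_mon \<beta>)
    = of_bool (\<beta> \<in> Comp (sum_list \<alpha>) \<and> partial_sums \<alpha> \<subseteq> partial_sums \<beta>)"
proof -
  have "QF \<alpha> (first_mon \<beta>) = (\<Sum>\<gamma>\<in>Comp (sum_list \<alpha>).
      if \<gamma> = \<beta> then of_bool (partial_sums \<alpha> \<subseteq> partial_sums \<beta>) else 0)"
    unfolding QF_eq using assms by (intro sum.cong) (auto simp: QM_first_mon Comp_def)
  then show ?thesis by simp
qed

section \<open>Endomorphisms and the coproduct\<close>

text \<open>Among all cuts of all compositions, only \<open>\<alpha> @ \<beta>\<close> cut at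
  \<open>length \<alpha>\<close> contributes: deconcatenation read on coefficients.\<close>

lemma coprod_first_mon:
  assumes f: "f \<in> QSym" and comp: "is_comp \<alpha>" "is_comp \<beta>"
  shows "coprod f (first_mon \<alpha>, first_mon \<beta>) = f (first_mon (\<alpha> @ \<beta>))"
proof -
  have inner: "(\<Sum>i\<le>length \<gamma>. tensor (QM (take i \<gamma>)) (QM (drop i \<gamma>)) (first_mon \<alpha>, first_mon \<beta>))
      = of_bool (\<gamma> = \<alpha> @ \<beta>)" if "is_comp \<gamma>" for \<gamma>
  proof -
    have "is_comp (take i \<gamma>)" "is_comp (drop i \<gamma>)" for i
      using that unfolding is_comp_def by (meson in_set_takeD in_set_dropD)+
    then have "tensor (QM (take i \<gamma>)) (QM (drop i \<gamma>)) (first_mon \<alpha>, first_mon \<beta>)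
        = of_bool (take i \<gamma> = \<alpha> \<and> drop i \<gamma> = \<beta>)" for i
      using comp by (simp add: tensor_def QM_first_mon flip: of_bool_conj)
    moreover have "i \<le> length \<gamma> \<Longrightarrow> take i \<gamma> = \<alpha> \<and> drop i \<gamma> = \<beta> \<longleftrightarrow> i = length \<alpha> \<and> \<gamma> = \<alpha> @ \<beta>" for i
      by (auto simp: min_def)
    ultimately have "(\<Sum>i\<le>length \<gamma>. tensor (QM (take i \<gamma>)) (QM (drop i \<gamma>)) (first_mon \<alpha>, first_mon \<beta>))
        = (\<Sum>i\<le>length \<gamma>. if i = length \<alpha> then of_bool (\<gamma> = \<alpha> @ \<beta>) else 0)"
      by (intro sum.cong refl) auto
    also have "\<dots> = of_bool (\<gamma> = \<alpha> @ \<beta>)" by (cases "\<gamma> = \<alpha> @ \<beta>") auto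
    finally show ?thesis .
  qed
  have "coprod f (first_mon \<alpha>, first_mon \<beta>) =
      (\<Sum>\<gamma>\<in>{\<gamma>. is_comp \<gamma> \<and> f (first_mon \<gamma>) \<noteq> 0}.
        if \<gamma> = \<alpha> @ \<beta> then f (first_mon (\<alpha> @ \<beta>)) else 0)"
    unfolding coprod_def by (intro sum.cong refl) (simp add: inner)
  then show ?thesis using finite_QSym_support[OF f] comp by simp
qed

lemma End_QSymD:
  assumes "\<Phi> \<in> End_QSym" "f \<in> QSym"
  shows End_QSym_closed: "\<Phi> f \<in> QSym"
    and End_QSym_scale: "\<Phi> (\<lambda>m. s * f m) = (\<lambda>m. s * \<Phi> f m)"
    and End_QSym_homogeneous: "homogeneous d f \<Longrightarrow> homogeneous d (\<Phi> f)"
    and End_QSym_coprod: "coprod (\<Phi> f) = tensor_map \<Phi> (coprod f)"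
  using assms by (auto simp: End_QSym_def)

lemma End_QSym_add:
  "\<Phi> \<in> End_QSym \<Longrightarrow> f \<in> QSym \<Longrightarrow> g \<in> QSym \<Longrightarrow> \<Phi> (\<lambda>m. f m + g m) = (\<lambda>m. \<Phi> f m + \<Phi> g m)"
  by (simp add: End_QSym_def)

lemma End_QSym_sum:
  assumes \<Phi>: "\<Phi> \<in> End_QSym" and "finite B" "\<And>b. b \<in> B \<Longrightarrow> g b \<in> QSym"
  shows "\<Phi> (\<lambda>m. \<Sum>b\<in>B. c b * g b m) = (\<lambda>m. \<Sum>b\<in>B. c b * \<Phi> (g b) m)"
  using assms(2,3)
proof (induction B rule: finite_induct)
  case empty
  show ?case using End_QSym_scale[OF \<Phi> QSym_zero, of 0] by simp
next
  case (insert b B)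
  then show ?case
    by (simp add: End_QSym_add[OF \<Phi>] QSym_scale QSym_sum End_QSym_scale[OF \<Phi>])
qed

lemma End_QSym_QM_first_mon_eq_0:
  assumes "\<Phi> \<in> End_QSym" "is_comp \<alpha>" "is_comp \<beta>" "sum_list \<alpha> \<noteq> sum_list \<beta>"
  shows "\<Phi> (QM \<alpha>) (first_mon \<beta>) = 0"
  using End_QSym_homogeneous[OF assms(1) QM_in_QSym homogeneous_QM, of \<alpha>] assms
  by (auto simp: homogeneous_def deg_first_mon)

text \<open>Compatibility with the coproduct, compared at the coefficient of
  \<open>(\<alpha>, \<beta>)\<close>. The grading confines the sum to compositions of the two block
  sizes.\<close>

lemma End_QSym_first_mon_append:
  assumes \<Phi>: "\<Phi> \<in> End_QSym" and f: "f \<in> QSym" and comp: "is_comp \<alpha>" "is_comp \<beta>"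
  shows "\<Phi> f (first_mon (\<alpha> @ \<beta>)) =
    (\<Sum>(\<gamma>, \<delta>)\<in>Comp (sum_list \<alpha>) \<times> Comp (sum_list \<beta>).
      f (first_mon (\<gamma> @ \<delta>)) * (\<Phi> (QM \<gamma>) (first_mon \<alpha>) * \<Phi> (QM \<delta>) (first_mon \<beta>)))"
proof -
  let ?t = "\<lambda>(\<gamma>, \<delta>).
      f (first_mon (\<gamma> @ \<delta>)) * (\<Phi> (QM \<gamma>) (first_mon \<alpha>) * \<Phi> (QM \<delta>) (first_mon \<beta>))"
  \<comment> \<open>\<open>S\<close> is the index set used by \<open>tensor_map\<close>. It is
    exchanged for the index set of the claim through their union: outside \<open>S\<close> the
    coefficient of \<open>f\<close> vanishes, outside the other set a value of \<Phi> does.\<close>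
  define S where "S = {(\<gamma>, \<delta>). is_comp \<gamma> \<and> is_comp \<delta> \<and> f (first_mon (\<gamma> @ \<delta>)) \<noteq> 0}"
  let ?T = "Comp (sum_list \<alpha>) \<times> Comp (sum_list \<beta>)"
  \<comment> \<open>Each pair in \<open>S\<close> is a cut of one of the finitely many compositions
    supporting \<open>f\<close>.\<close>
  have "S \<subseteq> (\<Union>\<gamma>\<in>{\<gamma>. is_comp \<gamma> \<and> f (first_mon \<gamma>) \<noteq> 0}.
      (\<lambda>i. (take i \<gamma>, drop i \<gamma>)) ` {..length \<gamma>})"
  proof
    fix x assume "x \<in> S"
    then obtain \<gamma> \<delta> where "x = (\<gamma>, \<delta>)" "is_comp (\<gamma> @ \<delta>)" "f (first_mon (\<gamma> @ \<delta>)) \<noteq> 0"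
      by (auto simp: S_def)
    then show "x \<in> (\<Union>\<gamma>\<in>{\<gamma>. is_comp \<gamma> \<and> f (first_mon \<gamma>) \<noteq> 0}.
        (\<lambda>i. (take i \<gamma>, drop i \<gamma>)) ` {..length \<gamma>})"
      by (intro UN_I[of "\<gamma> @ \<delta>"] image_eqI[of _ _ "length \<gamma>"]) auto
  qed
  then have fin: "finite S"
    by (rule finite_subset) (intro finite_UN_I finite_QSym_support[OF f] finite_imageI finite_atMost)
  have "\<Phi> f (first_mon (\<alpha> @ \<beta>)) = tensor_map \<Phi> (coprod f) (first_mon \<alpha>, first_mon \<beta>)"
    using coprod_first_mon[OF End_QSym_closed[OF \<Phi> f] comp] End_QSym_coprod[OF \<Phi> f] by simp
  also have "\<dots> = sum ?t S"
    unfolding tensor_map_def S_def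
    by (intro sum.cong) (auto simp: coprod_first_mon[OF f] tensor_def)
  also have "\<dots> = sum ?t (S \<union> ?T)"
    by (intro sum.mono_neutral_left) (use fin in \<open>auto simp: S_def dest: Comp_is_comp\<close>)
  also have "\<dots> = sum ?t ?T"
  proof (intro sum.mono_neutral_right ballI)
    fix x assume x: "x \<in> (S \<union> ?T) - ?T"
    then obtain \<gamma> \<delta> where "x = (\<gamma>, \<delta>)" "is_comp \<gamma>" "is_comp \<delta>"
      "sum_list \<gamma> \<noteq> sum_list \<alpha> \<or> sum_list \<delta> \<noteq> sum_list \<beta>"
      by (auto simp: S_def Comp_def)
    then show "?t x = 0" using End_QSym_QM_first_mon_eq_0[OF \<Phi>] comp by auto
  qed (use fin in auto)
  finally show ?thesis .
qed

lemma End_QSym_QF: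
  assumes "\<Phi> \<in> End_QSym"
  shows "\<Phi> (QF \<alpha>) m = (\<Sum>\<beta>\<in>Comp (sum_list \<alpha>).
    of_bool (partial_sums \<alpha> \<subseteq> partial_sums \<beta>) * \<Phi> (QM \<beta>) m)"
  unfolding QF_eq by (subst End_QSym_sum[OF assms]) (auto dest: Comp_is_comp)

text \<open>The coefficient of \<open>QM \<gamma>\<close> in \<open>QF \<beta>\<close> is 1 if \<open>\<beta> \<le> \<gamma>\<close> and 0 otherwise, so the conditions
  on \<open>c\<close> form a unitriangular system.\<close>

lemma F_coeff_eqI:
  assumes \<Phi>: "\<Phi> \<in> End_QSym" and \<alpha>: "\<alpha> \<in> Comp n"
    and supp: "\<And>\<beta>. \<beta> \<notin> Comp n \<Longrightarrow> c \<beta> = 0"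
    and coeff: "\<And>\<gamma>. \<gamma> \<in> Comp n \<Longrightarrow> \<Phi> (QF \<alpha>) (first_mon \<gamma>) =
      (\<Sum>\<beta>\<in>{\<beta>\<in>Comp n. partial_sums \<beta> \<subseteq> partial_sums \<gamma>}. c \<beta>)"
  shows "F_coeff \<Phi> \<alpha> = c"
proof -
  have n: "sum_list \<alpha> = n" using \<alpha> by (simp add: Comp_def)
  have expand: "(\<Sum>\<beta>\<in>Comp n. b \<beta> * QF \<beta> (first_mon \<gamma>)) =
      (if \<gamma> \<in> Comp n then \<Sum>\<beta>\<in>{\<beta>\<in>Comp n. partial_sums \<beta> \<subseteq> partial_sums \<gamma>}. b \<beta> else 0)"
    if "is_comp \<gamma>" for b \<gamma>
  proof -
    have "(\<Sum>\<beta>\<in>Comp n. b \<beta> * QF \<beta> (first_mon \<gamma>)) =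
        (\<Sum>\<beta>\<in>Comp n. if \<gamma> \<in> Comp n \<and> partial_sums \<beta> \<subseteq> partial_sums \<gamma> then b \<beta> else 0)"
      using that by (intro sum.cong refl) (auto simp: QF_first_mon Comp_def)
    then show ?thesis by (auto simp flip: sum.inter_filter)
  qed
  have eq: "\<Phi> (QF \<alpha>) = (\<lambda>m. \<Sum>\<beta>\<in>Comp n. c \<beta> * QF \<beta> m)"
  proof (rule QSym_eqI)
    fix \<gamma> assume \<gamma>: "is_comp \<gamma>"
    show "\<Phi> (QF \<alpha>) (first_mon \<gamma>) = (\<Sum>\<beta>\<in>Comp n. c \<beta> * QF \<beta> (first_mon \<gamma>))"
    proof (cases "\<gamma> \<in> Comp n")
      case False
      then have "\<Phi> (QF \<alpha>) (first_mon \<gamma>) = 0"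
        using End_QSym_homogeneous[OF \<Phi> QF_in_QSym homogeneous_QF, of \<alpha>] \<gamma> n
        by (auto simp: homogeneous_def deg_first_mon Comp_def)
      then show ?thesis using False \<gamma> by (simp add: expand)
    qed (use coeff \<gamma> in \<open>simp add: expand\<close>)
  qed (use \<Phi> in \<open>auto intro: End_QSym_closed QSym_sum\<close>)
  \<comment> \<open>\<open>F_coeff\<close> is a definite description, so uniqueness of the expansion
    has to be shown as well.\<close>
  have unique: "b = c" if b: "\<forall>\<beta>. \<beta> \<notin> Comp n \<longrightarrow> b \<beta> = 0"
    "\<Phi> (QF \<alpha>) = (\<lambda>m. \<Sum>\<beta>\<in>Comp n. b \<beta> * QF \<beta> m)" for b
  proof
    have sums: "(\<Sum>\<beta>\<in>{\<beta>\<in>Comp n. partial_sums \<beta> \<subseteq> partial_sums \<gamma>}. b \<beta>) =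
        (\<Sum>\<beta>\<in>{\<beta>\<in>Comp n. partial_sums \<beta> \<subseteq> partial_sums \<gamma>}. c \<beta>)" if "\<gamma> \<in> Comp n" for \<gamma>
      using fun_cong[OF b(2), of "first_mon \<gamma>"] coeff[OF that] that expand[of \<gamma> b]
      by (auto simp: Comp_def)
    have fin: "finite (partial_sums \<gamma>)" if "\<gamma> \<in> Comp n" for \<gamma>
      using partial_sums_subset[of \<gamma>] that finite_subset by (fastforce simp: Comp_def)
    have "b \<gamma> = c \<gamma>" if "\<gamma> \<in> Comp n" for \<gamma>
      using that
    proof (induction "card (partial_sums \<gamma>)" arbitrary: \<gamma> rule: less_induct)
      case less
      let ?B = "{\<beta>\<in>Comp n. partial_sums \<beta> \<subset> partial_sums \<gamma>}"
      \<comment> \<open>Equal partial sums force equal compositions, so \<gamma> is the only index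
        not covered by the induction hypothesis.\<close>
      have split: "{\<beta>\<in>Comp n. partial_sums \<beta> \<subseteq> partial_sums \<gamma>} = insert \<gamma> ?B"
        using less.prems inj_on_partial_sums[of n] by (auto dest: inj_onD)
      have "sum b ?B = sum c ?B"
        using less.hyps psubset_card_mono[OF fin[OF less.prems]] by (intro sum.cong) auto
      then show ?case using sums[OF less.prems] unfolding split by simp
    qed
    then show "b \<gamma> = c \<gamma>" for \<gamma> using b(1) supp by (cases "\<gamma> \<in> Comp n") auto
  qed
  show ?thesis
    unfolding F_coeff_def n using supp eq unique by (intro the_equality) auto
qed

section \<open>Evaluations\<close>

text \<open>Only the monomials \<open>mon js \<gamma>\<close> carry a nonzero coefficient, each
  arises from one \<open>js\<close>, and the sum is reindexed accordingly.\<close>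

lemma ps_eval_QM:
  assumes "is_comp \<gamma>"
  shows "ps_eval (QM \<gamma>) p =
    (\<Sum>\<^sub>\<infinity>js\<in>{js. length js = length \<gamma> \<and> sorted_wrt (<) js}. \<Prod>j<length \<gamma>. p (js ! j) ^ (\<gamma> ! j))"
proof -
  let ?J = "{js. length js = length \<gamma> \<and> sorted_wrt (<) js}"
  let ?p = "\<lambda>m. \<Prod>i\<in>Poly_Mapping.keys m. p i ^ Poly_Mapping.lookup m i"
  have inj: "inj_on (\<lambda>js. mon js \<gamma>) ?J"
    by (rule inj_onI) (use mon_inj[OF _ _ assms _ _ assms] in auto)
  have "ps_eval (QM \<gamma>) p = (\<Sum>\<^sub>\<infinity>m\<in>(\<lambda>js. mon js \<gamma>) ` ?J. ?p m)"
    unfolding ps_eval_def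
  proof (rule infsum_cong_neutral)
    fix m assume m: "m \<in> UNIV - (\<lambda>js. mon js \<gamma>) ` ?J"
    then have "{js. length js = length \<gamma> \<and> sorted_wrt (<) js \<and> mon js \<gamma> = m} = {}" by auto
    then have "QM \<gamma> m = 0" unfolding QM_def by (simp only: card.empty of_nat_0)
    then show "QM \<gamma> m * ?p m = 0" by simp
  qed (use assms in \<open>auto simp: QM_mon\<close>)
  also have "\<dots> = (\<Sum>\<^sub>\<infinity>js\<in>?J. ?p (mon js \<gamma>))"
    using inj by (simp add: infsum_reindex o_def)
  also have "\<dots> = (\<Sum>\<^sub>\<infinity>js\<in>?J. \<Prod>j<length \<gamma>. p (js ! j) ^ (\<gamma> ! j))"
    by (intro infsum_cong) (use prod_keys_mon[OF _ _ assms, where h = "\<lambda>i k. p i ^ k"] in auto)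
  finally show ?thesis .
qed

lemma first_mon_single_comp: "first_mon (single_comp d) = Poly_Mapping.single 0 d"
  by (simp add: first_mon_def single_comp_def mon_def)

text \<open>Of all monomials of degree \<open>d\<close>, only the power of the first variable
  survives the evaluation; for \<open>d = 0\<close> it is the constant monomial.\<close>

lemma ps_eval_first_variable:
  assumes "homogeneous d g"
  shows "ps_eval g (\<lambda>i. if i = 0 then 1 else 0) = g (first_mon (single_comp d))"
proof -
  let ?p = "\<lambda>m. \<Prod>i\<in>Poly_Mapping.keys m. (if i = 0 then 1 else 0) ^ Poly_Mapping.lookup m i :: real"
  have "ps_eval g (\<lambda>i. if i = 0 then 1 else 0) = (\<Sum>\<^sub>\<infinity>m\<in>{Poly_Mapping.single 0 d}. g m * ?p m)"
    unfolding ps_eval_def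
  proof (rule infsum_cong_neutral)
    fix m :: monomial assume m: "m \<in> UNIV - {Poly_Mapping.single 0 d}"
    show "g m * ?p m = 0"
    proof (rule ccontr)
      assume *: "g m * ?p m \<noteq> 0"
      have keys: "Poly_Mapping.keys m \<subseteq> {0}"
      proof
        fix i assume i: "i \<in> Poly_Mapping.keys m"
        \<comment> \<open>A nonzero product has no zero factor, whereas 0 to a positive exponent is
          one.\<close>
        then have "(if i = 0 then 1 else 0 :: real) ^ Poly_Mapping.lookup m i \<noteq> 0"
          using * by simp
        then show "i \<in> {0}" using i by (auto simp: in_keys_iff split: if_splits)
      qed
      have "Poly_Mapping.lookup m 0 = deg m"
        using keys by (cases "Poly_Mapping.keys m = {}")
          (auto simp: deg_def in_keys_iff subset_singleton_iff)
      moreover have "deg m = d" using * assms by (auto simp: homogeneous_def)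
      ultimately have "m = Poly_Mapping.single 0 d"
        using keys by (intro poly_mapping_eqI) (auto simp: lookup_single when_def in_keys_iff subset_iff)
      then show False using m by simp
    qed
  qed auto
  also have "\<dots> = g (first_mon (single_comp d))"
    by (simp add: first_mon_single_comp)
  finally show ?thesis .
qed

section \<open>Independent shifts\<close>

lemma pmf_replicate_pmf:
  "pmf (replicate_pmf n p) xs = (if length xs = n then prod_list (map (pmf p) xs) else 0)"
proof (induction n arbitrary: xs)
  case 0
  show ?case by (cases xs) auto
next
  case (Suc n)
  have eq: "replicate_pmf (Suc n) p = map_pmf (\<lambda>(x, xs). x # xs) (pair_pmf p (replicate_pmf n p))"
    by (simp add: pair_pmf_def map_bind_pmf)
  show ?case
  proof (cases xs)
    case Nil
    then show ?thesis unfolding eq by (auto simp: pmf_eq_0_set_pmf)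
  next
    case (Cons y ys)
    have "pmf (replicate_pmf (Suc n) p) ((\<lambda>(x, xs). x # xs) (y, ys))
        = pmf (pair_pmf p (replicate_pmf n p)) (y, ys)"
      unfolding eq by (rule pmf_map_inj') (auto simp: inj_def)
    then show ?thesis using Suc Cons by (simp add: pmf_pair)
  qed
qed

text \<open>The first \<open>m\<close> draws are independent of the last \<open>n\<close>.\<close>

lemma prob_replicate_pmf_append:
  fixes p :: "'a::countable pmf"
  shows "measure_pmf.prob (replicate_pmf (m + n) p) {zs. take m zs \<in> A \<and> drop m zs \<in> B} =
    measure_pmf.prob (replicate_pmf m p) A * measure_pmf.prob (replicate_pmf n p) B"
proof -
  let ?q = "pair_pmf (replicate_pmf m p) (replicate_pmf n p)"
  have "replicate_pmf (m + n) p = map_pmf (\<lambda>(x, y). x @ y) ?q"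
    by (simp add: replicate_pmf_distrib pair_pmf_def map_bind_pmf)
  then have "measure_pmf.prob (replicate_pmf (m + n) p) {zs. take m zs \<in> A \<and> drop m zs \<in> B} =
      measure_pmf.prob ?q ((\<lambda>(x, y). x @ y) -` {zs. take m zs \<in> A \<and> drop m zs \<in> B})"
    by simp
  also have "\<dots> = measure_pmf.prob ?q (A \<times> B)"
    \<comment> \<open>Cutting \<open>x @ y\<close> at \<open>m\<close> returns \<open>x\<close> and
      \<open>y\<close> only if \<open>x\<close> has length \<open>m\<close>, which holds almost
      surely.\<close>
    by (rule measure_pmf.finite_measure_eq_AE)
      (auto simp: AE_measure_pmf_iff set_replicate_pmf)
  also have "\<dots> = measure_pmf.prob (replicate_pmf m p) A * measure_pmf.prob (replicate_pmf n p) B"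
    by (intro measure_pmf_prob_product) auto
  finally show ?thesis .
qed

lemma measure_pmf_conv_infsum: "measure_pmf.prob q A = (\<Sum>\<^sub>\<infinity>x\<in>A. pmf q x)"
  by (simp add: measure_pmf_conv_infsetsum infsetsum_infsum pmf_abs_summable)

lemma prod_list_run_length_decode:
  fixes h :: "nat \<Rightarrow> 'a::comm_monoid_mult"
  assumes "length js = length \<gamma>"
  shows "prod_list (map h (run_length_decode \<gamma> js)) = (\<Prod>j<length \<gamma>. h (js ! j) ^ (\<gamma> ! j))"
  using assms
proof (induction js \<gamma> rule: list_induct2)
  case (Cons j js c \<gamma>)
  have "prod_list (map h (replicate c j)) = h j ^ c" by (induction c) auto
  then show ?case using Cons by (simp add: prod.lessThan_Suc_shift del: prod.lessThan_Suc)
qed simp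

text \<open>A decoded sequence has as its probability the value at \<open>pmf p\<close> of the
  corresponding monomial; summing over \<open>js\<close> evaluates
  \<open>QM \<gamma>\<close>.\<close>

lemma prob_run_length_decode:
  assumes "\<gamma> \<in> Comp n"
  shows "measure_pmf.prob (replicate_pmf n p)
      (run_length_decode \<gamma> ` {js. length js = length \<gamma> \<and> sorted_wrt (<) js}) = ps_eval (QM \<gamma>) (pmf p)"
proof -
  let ?J = "{js. length js = length \<gamma> \<and> sorted_wrt (<) js}"
  have comp: "is_comp \<gamma>" using assms by (rule Comp_is_comp)
  have "inj_on (run_length_decode \<gamma>) ?J"
    using run_length_decode_inj[OF _ comp _ _ comp] by (auto intro!: inj_onI)
  then have "measure_pmf.prob (replicate_pmf n p) (run_length_decode \<gamma> ` ?J)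
      = (\<Sum>\<^sub>\<infinity>js\<in>?J. pmf (replicate_pmf n p) (run_length_decode \<gamma> js))"
    by (simp add: measure_pmf_conv_infsum infsum_reindex o_def)
  also have "\<dots> = ps_eval (QM \<gamma>) (pmf p)"
    unfolding ps_eval_QM[OF comp] using assms
    by (intro infsum_cong)
      (auto simp: pmf_replicate_pmf length_run_length_decode prod_list_run_length_decode Comp_def)
  finally show ?thesis .
qed

text \<open>The right-hand side is the value of \<open>QF (desc_comp u)\<close> at
  \<open>pmf p\<close>, expanded in the \<open>QM\<close>. The event splits by run lengths,
  disjointly because decoding is injective.\<close>

lemma prob_no_descents:
  assumes u: "set u \<subseteq> {0<..real N}"
  shows "measure_pmf.prob (replicate_pmf (length u) p) {ds. descents (shift_word N u ds) = {}} =
    (\<Sum>\<gamma>\<in>Comp (length u). of_bool (descents u \<subseteq> partial_sums \<gamma>) * ps_eval (QM \<gamma>) (pmf p))"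
proof -
  let ?n = "length u" and ?q = "replicate_pmf (length u) p"
  let ?G = "{\<gamma>\<in>Comp ?n. descents u \<subseteq> partial_sums \<gamma>}"
  define R where "R \<gamma> = run_length_decode \<gamma> ` {js. length js = length \<gamma> \<and> sorted_wrt (<) js}" for \<gamma>
  have "measure_pmf.prob ?q {ds. descents (shift_word N u ds) = {}} = measure_pmf.prob ?q (\<Union>\<gamma>\<in>?G. R \<gamma>)"
  proof (rule measure_pmf.finite_measure_eq_AE)
    have "descents (shift_word N u ds) = {} \<longleftrightarrow> ds \<in> (\<Union>\<gamma>\<in>?G. R \<gamma>)" if "ds \<in> set_pmf ?q" for ds
    proof -
      have "length ds = length u" using that by (simp add: set_replicate_pmf)
      from no_descents_shift_word_iff[OF u this] show ?thesis by (auto simp: R_def)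
    qed
    then show "AE ds in ?q. ds \<in> {ds. descents (shift_word N u ds) = {}} \<longleftrightarrow> ds \<in> (\<Union>\<gamma>\<in>?G. R \<gamma>)"
      unfolding AE_measure_pmf_iff by blast
  qed auto
  also have "\<dots> = (\<Sum>\<gamma>\<in>?G. measure_pmf.prob ?q (R \<gamma>))"
  proof (rule measure_pmf.finite_measure_finite_Union)
    show "disjoint_family_on R ?G"
      unfolding disjoint_family_on_def R_def
      by (auto dest!: Comp_is_comp dest: run_length_decode_inj)
  qed auto
  also have "\<dots> = (\<Sum>\<gamma>\<in>?G. ps_eval (QM \<gamma>) (pmf p))"
    unfolding R_def by (intro sum.cong) (auto simp: prob_run_length_decode)
  also have "\<dots> = (\<Sum>\<gamma>\<in>Comp ?n. of_bool (descents u \<subseteq> partial_sums \<gamma>) * ps_eval (QM \<gamma>) (pmf p))"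
    by (simp add: sum.inter_filter of_bool_def if_distrib[of "\<lambda>x. x * _"] cong: if_cong)
  finally show ?thesis .
qed

section \<open>Coefficients of images of \<open>QF\<close> as descent probabilities\<close>

lemma End_QSym_QF_single_comp:
  assumes \<Phi>: "\<Phi> \<in> End_QSym"
    and eval: "\<And>G. G \<in> QSym \<Longrightarrow> ps_eval (\<Phi> G) (\<lambda>i. if i = 0 then 1 else 0) = ps_eval G (pmf p)"
    and u: "set u \<subseteq> {0<..real N}"
  shows "\<Phi> (QF (desc_comp u)) (first_mon (single_comp (length u))) =
    measure_pmf.prob (replicate_pmf (length u) p) {ds. descents (shift_word N u ds) = {}}"
proof -
  \<comment> \<open>The coefficient is the value of the image at the first unit vector, which
    \<open>eval\<close> identifies.\<close>
  have "\<Phi> (QM \<gamma>) (first_mon (single_comp (length u))) = ps_eval (QM \<gamma>) (pmf p)"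
    if "\<gamma> \<in> Comp (length u)" for \<gamma>
  proof -
    have comp: "is_comp \<gamma>" and sum: "sum_list \<gamma> = length u" using that by (auto simp: Comp_def)
    have "homogeneous (length u) (\<Phi> (QM \<gamma>))"
      using End_QSym_homogeneous[OF \<Phi> QM_in_QSym[OF comp] homogeneous_QM[OF comp]] sum by simp
    then show ?thesis
      using ps_eval_first_variable eval[OF QM_in_QSym[OF comp]] by metis
  qed
  then show ?thesis by (simp add: End_QSym_QF[OF \<Phi>] prob_no_descents[OF u])
qed

text \<open>Induction on \<beta>: the coproduct splits off the first block, and independence of the
  shifts multiplies the probabilities of the two subwords. The modulus \<open>N\<close> stays fixed
  while the words shorten.\<close>

lemma End_QSym_QF_first_mon:
  assumes \<Phi>: "\<Phi> \<in> End_QSym"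
    and eval: "\<And>G. G \<in> QSym \<Longrightarrow> ps_eval (\<Phi> G) (\<lambda>i. if i = 0 then 1 else 0) = ps_eval G (pmf p)"
  shows "\<beta> \<in> Comp (length u) \<Longrightarrow> set u \<subseteq> {0<..real N} \<Longrightarrow>
    \<Phi> (QF (desc_comp u)) (first_mon \<beta>) =
    measure_pmf.prob (replicate_pmf (length u) p) {ds. descents (shift_word N u ds) \<subseteq> partial_sums \<beta>}"
proof (induction \<beta> arbitrary: u)
  case Nil
  then show ?case
    using End_QSym_QF_single_comp[OF \<Phi> eval, of u N] by (simp add: Comp_def single_comp_def)
next
  case (Cons b \<beta>)
  define t d where "t = take b u" and "d = drop b u"
  have b: "0 < b" and comp: "is_comp [b]" "is_comp \<beta>" and len: "length u = b + sum_list \<beta>"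
    using Cons.prems by (auto simp: Comp_def)
  then have len_td: "length t = b" "length d = sum_list \<beta>" by (auto simp: t_def d_def)
  have "set t \<subseteq> set u" "set d \<subseteq> set u"
    by (simp_all add: t_def d_def set_take_subset set_drop_subset)
  then have bounds: "set t \<subseteq> {0<..real N}" "set d \<subseteq> {0<..real N}" using Cons.prems by auto
  have "\<Phi> (QF (desc_comp u)) (first_mon ([b] @ \<beta>)) =
      (\<Sum>(\<gamma>, \<delta>)\<in>Comp b \<times> Comp (sum_list \<beta>).
        QF (desc_comp u) (first_mon (\<gamma> @ \<delta>)) * (\<Phi> (QM \<gamma>) (first_mon [b]) * \<Phi> (QM \<delta>) (first_mon \<beta>)))"
    using End_QSym_first_mon_append[OF \<Phi> QF_in_QSym comp] by simp
  \<comment> \<open>By \<open>descents_split\<close> the coefficient of \<open>QF\<close> is a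
    product of indicators for \<open>t\<close> and \<open>d\<close>, so the double sum
    factors.\<close>
  also have "\<dots> = (\<Sum>(\<gamma>, \<delta>)\<in>Comp b \<times> Comp (sum_list \<beta>).
      (of_bool (descents t \<subseteq> partial_sums \<gamma>) * \<Phi> (QM \<gamma>) (first_mon [b])) *
      (of_bool (descents d \<subseteq> partial_sums \<delta>) * \<Phi> (QM \<delta>) (first_mon \<beta>)))"
  proof (intro sum.cong refl, clarify)
    fix \<gamma> \<delta> assume gd: "\<gamma> \<in> Comp b" "\<delta> \<in> Comp (sum_list \<beta>)"
    then have "is_comp \<gamma>" "is_comp \<delta>" "sum_list \<gamma> = b" "length u = sum_list \<gamma> + sum_list \<delta>"
      using len by (auto simp: Comp_def)
    then have "QF (desc_comp u) (first_mon (\<gamma> @ \<delta>)) =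
        of_bool (descents t \<subseteq> partial_sums \<gamma> \<and> descents d \<subseteq> partial_sums \<delta>)"
      using descents_split[of \<gamma> \<delta> u] by (simp add: QF_first_mon Comp_def t_def d_def)
    then show "QF (desc_comp u) (first_mon (\<gamma> @ \<delta>)) * (\<Phi> (QM \<gamma>) (first_mon [b]) * \<Phi> (QM \<delta>) (first_mon \<beta>)) =
        of_bool (descents t \<subseteq> partial_sums \<gamma>) * \<Phi> (QM \<gamma>) (first_mon [b]) *
        (of_bool (descents d \<subseteq> partial_sums \<delta>) * \<Phi> (QM \<delta>) (first_mon \<beta>))"
      by (simp add: of_bool_conj)
  qed
  also have "\<dots> = \<Phi> (QF (desc_comp t)) (first_mon [b]) * \<Phi> (QF (desc_comp d)) (first_mon \<beta>)"
    by (simp only: End_QSym_QF[OF \<Phi>] sum_list_desc_comp partial_sums_desc_comp len_td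
      sum_product sum.cartesian_product)
  \<comment> \<open>As \<open>b\<close> is positive, \<open>[b]\<close> is
    \<open>single_comp b\<close>, and the one-block formula applies.\<close>
  also have "\<Phi> (QF (desc_comp t)) (first_mon [b]) =
      measure_pmf.prob (replicate_pmf b p) {ds. descents (shift_word N t ds) = {}}"
    using End_QSym_QF_single_comp[OF \<Phi> eval bounds(1)] b len_td by (simp add: single_comp_def)
  also have "\<Phi> (QF (desc_comp d)) (first_mon \<beta>) =
      measure_pmf.prob (replicate_pmf (sum_list \<beta>) p) {ds. descents (shift_word N d ds) \<subseteq> partial_sums \<beta>}"
    using Cons.IH[of d] bounds(2) len_td comp by (simp add: Comp_def)
  also have "measure_pmf.prob (replicate_pmf b p) {ds. descents (shift_word N t ds) = {}} * \<dots> =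
      measure_pmf.prob (replicate_pmf (length u) p) {ds. take b ds \<in> {ds. descents (shift_word N t ds) = {}} \<and>
        drop b ds \<in> {ds. descents (shift_word N d ds) \<subseteq> partial_sums \<beta>}}"
    unfolding len by (rule prob_replicate_pmf_append[symmetric])
  also have "\<dots> = measure_pmf.prob (replicate_pmf (length u) p)
      {ds. descents (shift_word N u ds) \<subseteq> partial_sums ([b] @ \<beta>)}"
  proof (rule measure_pmf.finite_measure_eq_AE)
    have "(descents (shift_word N t (take b ds)) = {} \<and>
        descents (shift_word N d (drop b ds)) \<subseteq> partial_sums \<beta>) \<longleftrightarrow>
        descents (shift_word N u ds) \<subseteq> partial_sums ([b] @ \<beta>)" if "length ds = length u" for ds
      using descents_split[OF comp, of "shift_word N u ds"] that len
      by (simp add: take_shift_word drop_shift_word t_def d_def partial_sums_Cons[of b "[]"])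
    then show "AE ds in replicate_pmf (length u) p.
        ds \<in> {ds. take b ds \<in> {ds. descents (shift_word N t ds) = {}} \<and>
          drop b ds \<in> {ds. descents (shift_word N d ds) \<subseteq> partial_sums \<beta>}} \<longleftrightarrow>
        ds \<in> {ds. descents (shift_word N u ds) \<subseteq> partial_sums ([b] @ \<beta>)}"
      by (auto simp: AE_measure_pmf_iff set_replicate_pmf)
  qed auto
  finally show ?case by simp
qed

text \<open>The event that all descents lie in \<open>partial_sums \<gamma>\<close> is almost surely
  the disjoint union of the events \<open>E \<beta>\<close> with \<beta> below \<gamma>, so their
  probabilities solve the triangular system of \<open>F_coeff_eqI\<close>.\<close>

lemma F_coeff_desc_comp:
  assumes \<Phi>: "\<Phi> \<in> End_QSym"
    and eval: "\<And>G. G \<in> QSym \<Longrightarrow> ps_eval (\<Phi> G) (\<lambda>i. if i = 0 then 1 else 0) = ps_eval G (pmf p)"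
    and u: "set u \<subseteq> {0<..real N}"
  shows "F_coeff \<Phi> (desc_comp u) \<beta> = measure_pmf.prob (replicate_pmf (length u) p)
    {ds. length ds = length u \<and> desc_comp (shift_word N u ds) = \<beta>}"
proof -
  let ?q = "replicate_pmf (length u) p"
  \<comment> \<open>The length condition holds almost surely and makes \<open>E \<beta>\<close>
    empty for \<beta> outside \<open>Comp (length u)\<close>.\<close>
  define E where "E \<beta> = {ds. length ds = length u \<and> desc_comp (shift_word N u ds) = \<beta>}" for \<beta>
  have comp: "desc_comp (shift_word N u ds) \<in> Comp (length u)" if "length ds = length u" for ds
    using desc_comp_in_Comp[of "shift_word N u ds"] that by simp
  have "F_coeff \<Phi> (desc_comp u) = (\<lambda>\<beta>. measure_pmf.prob ?q (E \<beta>))"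
  proof (rule F_coeff_eqI[OF \<Phi> desc_comp_in_Comp])
    fix \<beta> assume "\<beta> \<notin> Comp (length u)"
    then have "E \<beta> = {}" using comp by (auto simp: E_def)
    then show "measure_pmf.prob ?q (E \<beta>) = 0" by simp
  next
    fix \<gamma> assume \<gamma>: "\<gamma> \<in> Comp (length u)"
    let ?B = "{\<beta>\<in>Comp (length u). partial_sums \<beta> \<subseteq> partial_sums \<gamma>}"
    have "\<Phi> (QF (desc_comp u)) (first_mon \<gamma>) =
        measure_pmf.prob ?q {ds. descents (shift_word N u ds) \<subseteq> partial_sums \<gamma>}"
      by (rule End_QSym_QF_first_mon[OF \<Phi> eval \<gamma> u])
    also have "\<dots> = measure_pmf.prob ?q (\<Union>\<beta>\<in>?B. E \<beta>)"
      using comp by (intro measure_pmf.finite_measure_eq_AE)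
        (auto simp: AE_measure_pmf_iff set_replicate_pmf E_def)
    also have "\<dots> = (\<Sum>\<beta>\<in>?B. measure_pmf.prob ?q (E \<beta>))"
      by (rule measure_pmf.finite_measure_finite_Union) (auto simp: disjoint_family_on_def E_def)
    finally show "\<Phi> (QF (desc_comp u)) (first_mon \<gamma>) = (\<Sum>\<beta>\<in>?B. measure_pmf.prob ?q (E \<beta>))" .
  qed
  then show ?thesis by (simp add: E_def)
qed

section \<open>The eigenvalue in degree one\<close>

lemma Comp_1: "Comp 1 = {[1]}"
proof -
  have "\<alpha> = [1]" if "is_comp \<alpha>" "sum_list \<alpha> = 1" for \<alpha>
  proof (cases \<alpha>)
    case (Cons a \<alpha>')
    then have "0 < a" "a + sum_list \<alpha>' = 1" "is_comp \<alpha>'" using that by auto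
    then have "a = 1" "sum_list \<alpha>' = 0" "is_comp \<alpha>'" by linarith+
    then show ?thesis using Cons by (cases \<alpha>') auto
  qed (use that in auto)
  then show ?thesis by (auto simp: Comp_def)
qed

text \<open>A one-letter word has no descents under any shift, so the coefficient of
  \<open>QM [1]\<close> in its image is the probability of a sure event. The normalisation in
  \<open>K_comp\<close> thus becomes trivial.\<close>

lemma eigval_eq_1:
  assumes \<Phi>: "\<Phi> \<in> End_QSym"
    and eval: "\<And>G. G \<in> QSym \<Longrightarrow> ps_eval (\<Phi> G) (\<lambda>i. if i = 0 then 1 else 0) = ps_eval G (pmf p)"
  shows "eigval \<Phi> = 1"
proof -
  have comp1: "is_comp [1::nat]" by simp
  have D: "desc_comp [1] = [1]" using desc_comp_in_Comp[of "[1]"] Comp_1 by simp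
  have QF: "QF [1] = QM [1]" using Comp_1 by (simp add: QF_eq partial_sums_Cons)
  have "descents (shift_word 1 [1] ds) = {}" for ds
    using descents_subset[of "shift_word 1 [1] ds"] by auto
  then have "{ds. descents (shift_word 1 [1] ds) \<subseteq> partial_sums [1]} = UNIV" by simp
  moreover have "\<Phi> (QF (desc_comp [1])) (first_mon [1]) = measure_pmf.prob (replicate_pmf (length [1::real]) p)
      {ds. descents (shift_word 1 [1] ds) \<subseteq> partial_sums [1]}"
    by (rule End_QSym_QF_first_mon[OF \<Phi> eval]) (auto simp: Comp_def)
  ultimately have "\<Phi> (QF (desc_comp [1])) (first_mon [1]) = 1"
    using measure_pmf.prob_space[of "replicate_pmf (length [1::real]) p"]
    by (simp only: space_measure_pmf)
  then have one: "\<Phi> (QM [1]) (first_mon [1]) = 1" by (simp only: D QF)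
  have "\<Phi> (QM [1]) = QM [1]"
  proof (rule QSym_eqI[OF End_QSym_closed[OF \<Phi> QM_in_QSym[OF comp1]] QM_in_QSym[OF comp1]])
    fix \<gamma> assume \<gamma>: "is_comp \<gamma>"
    show "\<Phi> (QM [1]) (first_mon \<gamma>) = QM [1] (first_mon \<gamma>)"
    proof (cases "\<gamma> = [1]")
      case False
      have "\<gamma> \<in> Comp 1 \<longleftrightarrow> \<gamma> = [1]" unfolding Comp_1 by blast
      then have "sum_list [1] \<noteq> sum_list \<gamma>" using \<gamma> False by (simp add: Comp_def)
      then show ?thesis
        using End_QSym_QM_first_mon_eq_0[OF \<Phi> comp1 \<gamma>] QM_first_mon[OF comp1 \<gamma>] False by auto
    qed (use one QM_first_mon[OF comp1 comp1] in simp)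
  qed
  moreover have "l = 1" if "QM [1] = (\<lambda>m. l * QM [1] m)" for l
    using fun_cong[OF that, of "first_mon [1]"] QM_first_mon[OF comp1 comp1] by simp
  ultimately show ?thesis
    unfolding eigval_def by (intro the_equality) simp_all
qed

text \<open>The variables may be read in the order of any injective \<open>f\<close>, because
  rearranged words carry their shifts along; the law of the vector is the same for every such
  \<open>f\<close>.\<close>

lemma (in prob_space) indep_replicate_pmf:
  fixes \<delta> :: "nat \<Rightarrow> 'a \<Rightarrow> nat"
  assumes indep: "indep_vars (\<lambda>_. count_space UNIV) \<delta> I"
    and f: "inj_on f {1..n}" "f ` {1..n} \<subseteq> I"
    and distr: "\<And>i j. i \<in> I \<Longrightarrow> prob {\<omega> \<in> space M. \<delta> i \<omega> = j} = pmf p j"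
  shows event_indep_replicate_pmf: "{\<omega> \<in> space M. map (\<lambda>i. \<delta> (f i) \<omega>) [1..<n + 1] \<in> X} \<in> events"
    and prob_indep_replicate_pmf: "prob {\<omega> \<in> space M. map (\<lambda>i. \<delta> (f i) \<omega>) [1..<n + 1] \<in> X} = measure_pmf.prob (replicate_pmf n p) X"
proof -
  define L where "L \<omega> = map (\<lambda>i. \<delta> (f i) \<omega>) [1..<n + 1]" for \<omega>
  have L_eq_iff: "L \<omega> = xs \<longleftrightarrow> length xs = n \<and> (\<forall>i\<in>{1..n}. \<delta> (f i) \<omega> = xs ! (i - 1))" for \<omega> xs
  proof -
    have nth: "L \<omega> ! k = \<delta> (f (Suc k)) \<omega>" if "k < n" for k
      using that by (simp add: L_def del: upt_Suc)
    have ball_iff: "(\<forall>i\<in>{1..n}. \<delta> (f i) \<omega> = xs ! (i - 1)) \<longleftrightarrow> (\<forall>k<n. \<delta> (f (Suc k)) \<omega> = xs ! k)"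
    proof -
      have "{1..n} = Suc ` {..<n}" by (simp add: image_Suc_lessThan)
      then show ?thesis by (auto simp: Ball_def)
    qed
    have "length (L \<omega>) = n" by (simp add: L_def)
    then show ?thesis unfolding ball_iff list_eq_iff_nth_eq using nth by auto
  qed
  have rv: "\<delta> i \<in> M \<rightarrow>\<^sub>M count_space UNIV" if "i \<in> I" for i
    using indep that by (auto simp: indep_vars_def)
  have event: "{\<omega> \<in> space M. \<delta> i \<omega> = j} \<in> events" if "i \<in> I" for i j
    using measurable_sets[OF rv[OF that], of "{j}"] by (simp add: vimage_def Int_def conj_commute)
  have L_event: "{\<omega> \<in> space M. L \<omega> = xs} \<in> events" for xs
  proof -
    have "{\<omega> \<in> space M. \<forall>i\<in>{1..n}. \<delta> (f i) \<omega> = xs ! (i - 1)} \<in> events"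
    proof (rule sets.sets_Collect_finite_All)
      fix i assume "i \<in> {1..n}"
      then have "f i \<in> I" using f(2) by blast
      then show "{\<omega> \<in> space M. \<delta> (f i) \<omega> = xs ! (i - 1)} \<in> events" by (rule event)
    qed simp
    then show ?thesis by (cases "length xs = n") (simp_all add: L_eq_iff)
  qed
  have L: "L \<in> M \<rightarrow>\<^sub>M count_space UNIV"
  proof (subst measurable_count_space_eq_countable)
    show "countable (UNIV :: nat list set)" by simp
    show "L \<in> space M \<rightarrow> UNIV \<and> (\<forall>xs\<in>UNIV. L -` {xs} \<inter> space M \<in> events)"
      using L_event by (auto simp: vimage_def Int_def conj_commute)
  qed
  show "{\<omega> \<in> space M. map (\<lambda>i. \<delta> (f i) \<omega>) [1..<n + 1] \<in> X} \<in> events"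
    using measurable_sets[OF L, of X] by (simp add: L_def vimage_def Int_def conj_commute)
  have point: "prob {\<omega> \<in> space M. L \<omega> = xs} = pmf (replicate_pmf n p) xs" for xs
  \<comment> \<open>The product rule is applied to a nonempty index set. For \<open>n = 0\<close>
    the vector is constantly empty, and for a wrong length both sides are 0.\<close>
  proof (cases "length xs = n \<and> n \<noteq> 0")
    case True
    have "{\<omega> \<in> space M. L \<omega> = xs} =
        (\<Inter>k\<in>f ` {1..n}. \<delta> k -` {xs ! (the_inv_into {1..n} f k - 1)} \<inter> space M)"
      using True f(1) by (auto simp: L_eq_iff the_inv_into_f_f)
    also have "prob \<dots> =
        (\<Prod>k\<in>f ` {1..n}. prob (\<delta> k -` {xs ! (the_inv_into {1..n} f k - 1)} \<inter> space M))"
      using True f(2) by (intro indep_varsD[OF indep]) auto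
    also have "\<dots> = (\<Prod>i\<in>{1..n}. prob {\<omega> \<in> space M. \<delta> (f i) \<omega> = xs ! (i - 1)})"
      using f(1) by (simp add: prod.reindex the_inv_into_f_f vimage_def Int_def conj_commute)
    also have "\<dots> = (\<Prod>i\<in>{1..n}. pmf p (xs ! (i - 1)))"
      using f(2) by (intro prod.cong refl distr) auto
    also have "\<dots> = (\<Prod>k<n. pmf p (xs ! k))"
      by (rule prod.reindex_bij_witness[of _ Suc "\<lambda>i. i - 1"]) auto
    also have "\<dots> = pmf (replicate_pmf n p) xs"
      using True by (simp add: pmf_replicate_pmf prod.list_conv_set_nth atLeast0LessThan)
    finally show ?thesis .
  next
    case False
    then show ?thesis by (auto simp: L_eq_iff pmf_replicate_pmf prob_space)
  qed
  \<comment> \<open>Lists of naturals are countable, so point masses determine the law.\<close>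
  have "distr M (count_space UNIV) L = measure_pmf (replicate_pmf n p)"
  proof (rule measure_eqI_countable[of _ UNIV])
    show "emeasure (distr M (count_space UNIV) L) {xs} = emeasure (measure_pmf (replicate_pmf n p)) {xs}" for xs
      using point[of xs]
      by (simp add: emeasure_distr[OF L] emeasure_eq_measure measure_pmf.emeasure_eq_measure
          measure_pmf_single vimage_def Int_def conj_commute)
  qed auto
  then have "measure (distr M (count_space UNIV) L) X = measure_pmf.prob (replicate_pmf n p) X" by simp
  then show "prob {\<omega> \<in> space M. map (\<lambda>i. \<delta> (f i) \<omega>) [1..<n + 1] \<in> X} =
      measure_pmf.prob (replicate_pmf n p) X"
    by (simp add: measure_distr[OF L] L_def vimage_def Int_def conj_commute)
qed

text \<open>Two letters differ by less than \<open>n\<close>, so equal values force equal shifts and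
  then equal letters. Hence shifted words have distinct entries and can be standardised.\<close>

lemma inj_on_add_mult:
  fixes \<sigma> d :: "nat \<Rightarrow> nat"
  assumes "\<sigma> permutes {1..n}" shows "inj_on (\<lambda>i. \<sigma> i + d i * n) {1..n}"
proof (rule inj_onI)
  fix i j assume ij: "i \<in> {1..n}" "j \<in> {1..n}" and eq: "\<sigma> i + d i * n = \<sigma> j + d j * n"
  have "\<sigma> i \<in> {1..n}" "\<sigma> j \<in> {1..n}" using permutes_in_image[OF assms] ij by blast+
  moreover have "(d i + 1) * n \<le> d j * n" if "d i < d j" by (rule mult_right_mono) (use that in auto)
  moreover have "(d j + 1) * n \<le> d i * n" if "d j < d i" by (rule mult_right_mono) (use that in auto)
  ultimately have "d i = d j" using eq by (cases "d i" "d j" rule: linorder_cases) auto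
  then have "\<sigma> i = \<sigma> j" using eq by simp
  then show "i = j" using permutes_inj[OF assms] by (simp add: inj_eq)
qed

section \<open>Both chains as laws of the randomly shifted word\<close>

theorem theorem6p3:
  fixes r :: "nat \<Rightarrow> real"
    and \<Phi> :: "pseries \<Rightarrow> pseries"
    and P :: "'a measure"
    and \<delta> :: "nat \<Rightarrow> 'a \<Rightarrow> nat"
  assumes r_nonneg: "\<And>j. 1 \<le> j \<Longrightarrow> 0 \<le> r j"
    and r_sum: "(\<lambda>i. r (i + 1)) sums 1"
    and Phi_End: "\<Phi> \<in> End_QSym"
    and Phi_eval: "\<And>G. G \<in> QSym \<Longrightarrow>
          ps_eval (\<Phi> G) (\<lambda>i. if i = 0 then 1 else 0) = ps_eval G (\<lambda>i. r (i + 1))"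
    and P: "prob_space P"
    and indep: "prob_space.indep_vars P (\<lambda>_. count_space UNIV) \<delta> {1..}"
    and distr: "\<And>i j. 1 \<le> i \<Longrightarrow> 1 \<le> j \<Longrightarrow> measure P {\<omega> \<in> space P. \<delta> i \<omega> = j - 1} = r j"
  shows "\<forall>n. \<forall>\<sigma> \<tau>. \<forall>\<beta>\<in>Comp n. \<sigma> permutes {1..n} \<longrightarrow> \<tau> permutes {1..n} \<longrightarrow>
      K_perm \<Phi> n \<sigma> \<tau> =
        measure P {\<omega> \<in> space P. st (word n (\<lambda>i. \<sigma> i + \<delta> i \<omega> * n)) = \<tau>} \<and>
      K_comp \<Phi> n (desc_comp (word n \<sigma>)) \<beta> =
        measure P {\<omega> \<in> space P. desc_comp (word n (\<lambda>i. \<sigma> i + \<delta> i \<omega> * n)) = \<beta>}"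
proof -
  interpret prob_space P by (rule P)
  \<comment> \<open>The weights \<open>r\<close> are indexed from 1, the shifts from 0.\<close>
  define p where "p = embed_pmf (\<lambda>j. r (j + 1))"
  have pmf_p: "pmf p j = r (j + 1)" for j
    unfolding p_def
  proof (rule pmf_embed_pmf)
    have "(\<integral>\<^sup>+ j. ennreal (r (j + 1)) \<partial>count_space UNIV) = suminf (\<lambda>j. ennreal (r (j + 1)))"
      by (rule nn_integral_count_space_nat)
    also have "\<dots> = ennreal (suminf (\<lambda>j. r (j + 1)))"
      using r_nonneg sums_summable[OF r_sum] by (intro suminf_ennreal2) auto
    also have "\<dots> = 1" using sums_unique[OF r_sum] by simp
    finally show "(\<integral>\<^sup>+ j. ennreal (r (j + 1)) \<partial>count_space UNIV) = 1" .
  qed (use r_nonneg in auto)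
  have eval: "ps_eval (\<Phi> G) (\<lambda>i. if i = 0 then 1 else 0) = ps_eval G (pmf p)" if "G \<in> QSym" for G
  proof -
    have "pmf p = (\<lambda>i. r (i + 1))" using pmf_p by (rule ext)
    then show ?thesis using Phi_eval[OF that] by simp
  qed
  have \<delta>_distr: "prob {\<omega> \<in> space P. \<delta> i \<omega> = j} = pmf p j" if "i \<in> {1..}" for i j
    using distr[of i "j + 1"] that by (simp add: pmf_p)
  have law: "{\<omega> \<in> space P. map (\<lambda>i. \<delta> (f i) \<omega>) [1..<n + 1] \<in> X} \<in> events"
    "prob {\<omega> \<in> space P. map (\<lambda>i. \<delta> (f i) \<omega>) [1..<n + 1] \<in> X} = measure_pmf.prob (replicate_pmf n p) X"
    if "f permutes {1..n}" for f n X
  proof -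
    have "f ` {1..n} \<subseteq> {1..}" using permutes_image[OF that] by auto
    from indep_replicate_pmf[OF indep permutes_inj_on[OF that] this \<delta>_distr]
    show "{\<omega> \<in> space P. map (\<lambda>i. \<delta> (f i) \<omega>) [1..<n + 1] \<in> X} \<in> events"
      "prob {\<omega> \<in> space P. map (\<lambda>i. \<delta> (f i) \<omega>) [1..<n + 1] \<in> X} =
        measure_pmf.prob (replicate_pmf n p) X" by blast+
  qed
  \<comment> \<open>Reading the shifted word along \<open>f\<close> permutes letters and shifts
    together, and permuted i.i.d. shifts have the same law.\<close>
  have F: "F_coeff \<Phi> (desc_comp (word n (\<sigma> \<circ> f))) \<beta> =
      prob {\<omega> \<in> space P. desc_comp (word n ((\<lambda>i. \<sigma> i + \<delta> i \<omega> * n) \<circ> f)) = \<beta>}"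
    if "\<sigma> permutes {1..n}" "f permutes {1..n}" for n \<sigma> f \<beta>
  proof -
    have bounds: "set (word n (\<sigma> \<circ> f)) \<subseteq> {0<..real n}"
      using permutes_compose[OF that(2,1)] by (rule set_word_permutes)
    have "word n ((\<lambda>i. \<sigma> i + \<delta> i \<omega> * n) \<circ> f) =
        shift_word n (word n (\<sigma> \<circ> f)) (map (\<lambda>i. \<delta> (f i) \<omega>) [1..<n + 1])" for \<omega>
      using word_eq_shift_word[of n "\<sigma> \<circ> f" "\<lambda>i. \<delta> (f i) \<omega>"] by (simp add: o_def)
    then show ?thesis
      using law(2)[OF that(2), of "{ds. length ds = n \<and> desc_comp (shift_word n (word n (\<sigma> \<circ> f)) ds) = \<beta>}"]
      by (simp add: F_coeff_desc_comp[OF Phi_End eval bounds] del: upt_Suc)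
  qed
  \<comment> \<open>The case \<open>f = inv \<tau>\<close>: descent composition
    \<open>single_comp n\<close> means no descents, which for the rearranged word means
    standardisation \<tau>.\<close>
  have F_st: "F_coeff \<Phi> (desc_comp (word n (\<sigma> \<circ> inv \<tau>))) (single_comp n) =
      prob {\<omega> \<in> space P. st (word n (\<lambda>i. \<sigma> i + \<delta> i \<omega> * n)) = \<tau>}"
    if \<sigma>: "\<sigma> permutes {1..n}" and \<tau>: "\<tau> permutes {1..n}" for n \<sigma> \<tau>
    unfolding F[OF \<sigma> permutes_inv[OF \<tau>]] st_word_eq_iff[OF inj_on_add_mult[OF \<sigma>] \<tau>]
    by (simp add: desc_comp_eq_iff)
  \<comment> \<open>With the identity for \<sigma>, the summands are the probabilities of the
    possible standardisations of one shifted word; these events partition the space.\<close>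
  have total: "(\<Sum>\<pi>\<in>{\<pi>. \<pi> permutes {1..n}}. F_coeff \<Phi> (desc_comp (word n \<pi>)) (single_comp n)) = 1" for n
  proof -
    let ?S = "{\<pi>. \<pi> permutes {1..n}}"
    let ?E = "\<lambda>\<tau>. {\<omega> \<in> space P. st (word n (\<lambda>i. id i + \<delta> i \<omega> * n)) = \<tau>}"
    have "(\<Sum>\<pi>\<in>?S. F_coeff \<Phi> (desc_comp (word n \<pi>)) (single_comp n)) =
        (\<Sum>\<tau>\<in>?S. F_coeff \<Phi> (desc_comp (word n (id \<circ> inv \<tau>))) (single_comp n))"
      unfolding id_comp by (rule sum_permutations_inverse)
    also have "\<dots> = (\<Sum>\<tau>\<in>?S. prob (?E \<tau>))"
      by (intro sum.cong refl F_st) (auto simp: permutes_id)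
    also have "\<dots> = prob (\<Union>\<tau>\<in>?S. ?E \<tau>)"
    proof (rule finite_measure_finite_Union[symmetric])
      have "?E \<tau> \<in> events" for \<tau>
        using law(1)[OF permutes_id, of n "{ds. st (shift_word n (word n id) ds) = \<tau>}"]
        by (simp add: word_eq_shift_word id_def del: upt_Suc)
      then show "?E ` ?S \<subseteq> events" by blast
    qed (auto simp: disjoint_family_on_def finite_permutations)
    also have "(\<Union>\<tau>\<in>?S. ?E \<tau>) = space P"
      using st_word_permutes[OF inj_on_add_mult[OF permutes_id]] by auto
    finally show ?thesis by (simp add: prob_space)
  qed
  show ?thesis
  proof (intro allI ballI impI conjI)
    fix n :: nat and \<sigma> \<tau> :: "nat \<Rightarrow> nat" and \<beta> :: "nat list"
    assume \<sigma>: "\<sigma> permutes {1..n}" and \<tau>: "\<tau> permutes {1..n}"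
    \<comment> \<open>This is the permutation at which \<open>K_perm\<close> evaluates
      \<open>Prob_End\<close>.\<close>
    have "inv (\<tau> \<circ> inv \<sigma>) = \<sigma> \<circ> inv \<tau>"
      by (simp add: o_inv_distrib permutes_bij[OF \<tau>] permutes_bij[OF permutes_inv[OF \<sigma>]]
          permutes_inv_inv[OF \<sigma>])
    then show "K_perm \<Phi> n \<sigma> \<tau> = prob {\<omega> \<in> space P. st (word n (\<lambda>i. \<sigma> i + \<delta> i \<omega> * n)) = \<tau>}"
      unfolding K_perm_def Prob_End_def total by (simp add: F_st[OF \<sigma> \<tau>])
    show "K_comp \<Phi> n (desc_comp (word n \<sigma>)) \<beta> =
        prob {\<omega> \<in> space P. desc_comp (word n (\<lambda>i. \<sigma> i + \<delta> i \<omega> * n)) = \<beta>}"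
      using F[OF \<sigma> permutes_id] by (simp add: K_comp_def eigval_eq_1[OF Phi_End eval])
  qed
qed

end
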